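(* (i) Let $x\in(0,1)$ be irrational and suppose that the derivative $?'(x)$ exists and $?'(x)=0$. Then for any $\varepsilon>0$, for all positive integers $t$ large enough one has $$\max_{u\le t}\varphi^{(1)}_{x}(u)\ge (\sqrt{2}-\varepsilon)\,\kappa_4\sqrt{t\log t}.$$ (ii) For any $\varepsilon>0$ there exists an irrational $x\in(0,1)$ such that $?'(x)=0$ and for infinitely many positive integers $t$ one has $$\max_{u\le t}\varphi^{(1)}_{x}(u)\le (\sqrt{2}+\varepsilon)\,\kappa_4\sqrt{t\log t}.$$ In both parts the maximum is over positive integers $u\le t$.
   Context: The Minkowski question-mark function $?:[0,1]\to[0,1]$ is the continuous strictly increasing function which at an irrational $x=[0;a_1,a_2,\ldots]$ (regular continued fraction with positive integer partial quotients) is given by $?(x)=\sum_{k=1}^{\infty}\frac{(-1)^{k+1}}{2^{a_1+\cdots+a_k-1}}$ (for rational $x$ the series is replaced by the corresponding finite sum). Its derivative at $x$ is denoted $?'(x)$. For irrational $x=[0;a_1,a_2,\ldots]$ put $S_x(t)=a_1+\cdots+a_t$ and $\varphi^{(1)}_x(t)=S_x(t)-\kappa_1 t$. Constants: $\kappa_1=\frac{2\log\Phi}{\log 2}$ with $\Phi=\frac{1+\sqrt5}{2}$, and $\kappa_4=\sqrt{\frac{\kappa_1-1}{\log 2}}$. Here $\log$ is the natural logarithm. *)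

theory Defs
  imports Complex_Main
begin

text \<open>
  Regular continued fractions of real numbers in \<open>[0,1]\<close>, obtained from the Gauss map:
  \<open>cf_rem x n\<close> is the tail \<open>[0; a\<^sub>n\<^sub>+\<^sub>1, a\<^sub>n\<^sub>+\<^sub>2, \<dots>]\<close> of \<open>x = [0; a\<^sub>1, a\<^sub>2, \<dots>]\<close>. The expansion of a
  rational number terminates at the first \<open>n\<close> with \<open>cf_rem x n = 0\<close>; all later remainders
  are then \<open>0\<close> as well.
\<close>

primrec cf_rem :: "real \<Rightarrow> nat \<Rightarrow> real" where
  "cf_rem x 0 = x"
| "cf_rem x (Suc n) = frac (1 / cf_rem x n)"

text \<open>
  The partial quotient \<open>a\<^sub>k\<close>, only meaningful for \<open>k \<ge> 1\<close> and \<open>cf_rem x (k - 1) \<noteq> 0\<close>.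
\<close>

definition cf_quot :: "real \<Rightarrow> nat \<Rightarrow> nat" where
  "cf_quot x k = nat \<lfloor>1 / cf_rem x (k - 1)\<rfloor>"

definition cf_sum :: "real \<Rightarrow> nat \<Rightarrow> nat" where
  "cf_sum x t = (\<Sum>k = 1..t. cf_quot x k)"

text \<open>
  The Minkowski question-mark function on \<open>[0,1]\<close> (the values outside are irrelevant).
  The summand with index \<open>n\<close> is the one for \<open>k = n + 1\<close>, whence the sign
  \<open>(-1)\<^sup>k\<^sup>+\<^sup>1 = (-1)\<^sup>n\<^sup>+\<^sup>2 = (-1)\<^sup>n\<close>. For rational \<open>x\<close> the
  summands beyond the end of the expansion are \<open>0\<close>, so the series is the finite sum over the
  existing partial quotients.
\<close>

definition minkowski_qm :: "real \<Rightarrow> real" where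
  "minkowski_qm x =
     (\<Sum>n. if cf_rem x n = 0 then 0 else (- 1) ^ n / 2 ^ (cf_sum x (Suc n) - 1))"

definition golden :: real where
  "golden = (1 + sqrt 5) / 2"

definition kappa1 :: real where
  "kappa1 = 2 * ln golden / ln 2"

definition kappa4 :: real where
  "kappa4 = sqrt ((kappa1 - 1) / ln 2)"

definition phi1 :: "real \<Rightarrow> nat \<Rightarrow> real" where
  "phi1 x t = real (cf_sum x t) - kappa1 * real t"

lemma cf_rem_bounds:
  assumes "0 \<le> x" "x \<le> 1"
  shows "0 \<le> cf_rem x n \<and> cf_rem x n \<le> 1"
  using assms by (cases n) (auto simp: frac_ge_0 less_imp_le[OF frac_lt_1])

lemma cf_rem_irrational:
  assumes "x \<notin> \<rat>"
  shows "cf_rem x n \<notin> \<rat>"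
proof (induction n)
  case 0
  then show ?case using assms by simp
next
  case (Suc n)
  show ?case
  proof
    assume "cf_rem x (Suc n) \<in> \<rat>"
    then have "frac (1 / cf_rem x n) + of_int \<lfloor>1 / cf_rem x n\<rfloor> \<in> \<rat>"
      by (simp add: Rats_add)
    then have "1 / cf_rem x n \<in> \<rat>" by (simp add: frac_def)
    from Rats_inverse[OF this] show False using Suc by simp
  qed
qed

lemma cf_quot_pos:
  assumes "0 \<le> x" "x \<le> 1" "cf_rem x n \<noteq> 0"
  shows "1 \<le> cf_quot x (Suc n)"
proof -
  have "1 \<le> 1 / cf_rem x n"
    using cf_rem_bounds[OF assms(1,2), of n] assms(3) by (simp add: field_simps)
  then have "1 \<le> \<lfloor>1 / cf_rem x n\<rfloor>" by linarith
  then have "1 \<le> nat \<lfloor>1 / cf_rem x n\<rfloor>" by linarith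
  then show ?thesis by (simp add: cf_quot_def)
qed

lemma cf_rem_rec:
  assumes "0 \<le> x" "x \<le> 1" "cf_rem x n \<noteq> 0"
  shows "cf_rem x n = 1 / (real (cf_quot x (Suc n)) + cf_rem x (Suc n))"
proof -
  have "0 \<le> \<lfloor>1 / cf_rem x n\<rfloor>"
    using cf_rem_bounds[OF assms(1,2), of n] by simp
  then have "real (cf_quot x (Suc n)) = of_int \<lfloor>1 / cf_rem x n\<rfloor>"
    by (simp add: cf_quot_def)
  then have "real (cf_quot x (Suc n)) + cf_rem x (Suc n) = 1 / cf_rem x n"
    by (simp add: frac_def)
  then show ?thesis by simp
qed

lemma cf_rem_0_mono:
  assumes "cf_rem x n = 0" "n \<le> m"
  shows "cf_rem x m = 0"
  using assms(2,1) by (induction rule: dec_induct) auto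

lemma cf_sum_ge:
  assumes "0 \<le> x" "x \<le> 1" "cf_rem x n \<noteq> 0"
  shows "Suc n \<le> cf_sum x (Suc n)"
proof -
  have "(\<Sum>k = 1..Suc n. 1) \<le> (\<Sum>k = 1..Suc n. cf_quot x k)"
  proof (rule sum_mono)
    fix k assume k: "k \<in> {1..Suc n}"
    then have "k - 1 \<le> n" by auto
    then have "cf_rem x (k - 1) \<noteq> 0"
      using cf_rem_0_mono[of x "k - 1" n] assms(3) by blast
    then show "1 \<le> cf_quot x k"
      using cf_quot_pos[OF assms(1,2), of "k - 1"] k by simp
  qed
  then show ?thesis by (simp add: cf_sum_def)
qed

lemma minkowski_qm_summable:
  assumes "0 \<le> x" "x \<le> 1"
  shows "summable (\<lambda>n. if cf_rem x n = 0 then 0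
                        else (- 1) ^ n / 2 ^ (cf_sum x (Suc n) - 1) :: real)"
proof (rule summable_comparison_test)
  show "summable (\<lambda>n. (1 / 2) ^ n :: real)" by (rule summable_geometric) simp
  show "\<exists>N. \<forall>n\<ge>N. norm (if cf_rem x n = 0 then 0
                        else (- 1) ^ n / 2 ^ (cf_sum x (Suc n) - 1) :: real) \<le> (1 / 2) ^ n"
  proof (intro exI allI impI)
    fix n
    show "norm (if cf_rem x n = 0 then 0
                else (- 1) ^ n / 2 ^ (cf_sum x (Suc n) - 1) :: real) \<le> (1 / 2) ^ n"
    proof (cases "cf_rem x n = 0")
      case False
      have "(2::real) ^ n \<le> 2 ^ (cf_sum x (Suc n) - 1)"
        using cf_sum_ge[OF assms False] by (intro power_increasing) auto
      then show ?thesis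
        using False by (simp add: power_abs power_one_over frac_le)
    qed simp
  qed
qed

end

theory Submission imports Defs "HOL-Real_Asymp.Real_Asymp" begin

text \<open>
  Write \<open>S\<^sub>t\<close> for the sum of the first \<open>t\<close> partial quotients of \<open>x\<close>, \<open>q\<^sub>t\<close> for the denominator of its
  \<open>t\<close>-th convergent and \<open>\<phi>(t) = S\<^sub>t - kappa1 t\<close>.

  Two points with the same first \<open>t\<close> quotients have distance of order \<open>q\<^sub>t\<^sup>-\<^sup>2\<close> times the distance of
  their remainders, while the distance of their values is exactly \<open>2 ^ (- S\<^sub>t)\<close> times that of the values at
  the remainders. As the question-mark function has bounded difference quotients between points with different first
  quotients, the derivative at \<open>x\<close> vanishes if \<open>q\<^sub>t\<^sup>2 / 2 ^ S\<^sub>t\<close> tends to 0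
  (\<open>den_bound_imp_deriv_0\<close>); conversely a vanishing derivative keeps this quantity bounded
  (\<open>deriv_0_imp_den_bound\<close>). Since \<open>q\<^sub>t\<close> lies, up to a constant, between \<open>\<Phi>\<^sup>t\<close> times the product of the
  \<open>(a\<^sub>k + 2) / 3\<close> and \<open>\<Phi>\<^sup>t\<close> times the product of the \<open>a\<^sub>k\<close> (\<open>cf_den_lower\<close>, \<open>cf_den_upper\<close>), and
  \<open>kappa1 = 2 log\<^sub>2 \<Phi>\<close>, a vanishing derivative amounts, roughly, to
  \<open>\<phi>(t) \<ge> B(t)\<close> for the floor \<open>B(t) = (2 / ln 2) \<Sum> ln a\<^sub>k\<close>.

  What remains is a problem about walks. Each step adds \<open>a - kappa1\<close> to \<open>\<phi>\<close>, which is negative for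
  \<open>a = 1\<close>, so that larger quotients must come again and again. Each of them raises the floor \<open>B\<close>
  by \<open>(2 / ln 2) ln a\<close>, and under a ceiling \<open>N\<close> it can be at most about \<open>N - B\<close>, which feeds
  \<open>(N - B) / (kappa1 - 1)\<close> steps. With \<open>ln a \<approx> ln N\<close>, the walk survives at most
  \<open>ln 2 / (2 (kappa1 - 1) ln N)\<close> times \<open>\<integral> (N - B) dB = N\<^sup>2 / 2\<close> steps, that is,
  \<open>t \<approx> N\<^sup>2 / (4 kappa4\<^sup>2 ln N)\<close>. As \<open>ln N \<approx> (ln t) / 2\<close>, this gives \<open>N\<^sup>2 \<approx> 2 kappa4\<^sup>2 t ln t\<close>.

  The upper bound on the survival time (\<open>bounded_drift_time_bound\<close>) proves the first part. For the
  second part, always using the largest quotient that fits below the ceiling attains it up to a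
  factor near 1 (\<open>controlled_cycles\<close>). Such a block belongs to a single time scale; blocks at
  rapidly growing scales are concatenated (\<open>ex_sequence\<close>), and the bound holds at the end of each of them.
\<close>

section \<open>The functional equation and Lipschitz bounds at reciprocals\<close>

lemma cf_rem_Suc_frac: "cf_rem x (Suc n) = cf_rem (frac (1 / x)) n"
  by (induction n) auto

lemma cf_quot_Suc_frac: "k \<ge> 1 \<Longrightarrow> cf_quot x (Suc k) = cf_quot (frac (1 / x)) k"
  unfolding cf_quot_def using cf_rem_Suc_frac[of x "k - 1"] by (cases k) auto

lemma cf_sum_eq: "cf_sum x t = (\<Sum>k<t. cf_quot x (Suc k))"
  unfolding cf_sum_def by (simp add: sum.atLeast1_atMost_eq)

lemma cf_quot_rem: "cf_quot (cf_rem x n) 1 = cf_quot x (Suc n)"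
  by (simp add: cf_quot_def)

text \<open>
  Dropping the first partial quotient shifts the alternating series and rescales it. Apart from a
  crude bound, everything below about the question-mark function comes from this functional equation.
\<close>

lemma qm_step:
  assumes "0 < x" "x \<le> 1"
  shows "minkowski_qm x = (2 - minkowski_qm (frac (1 / x))) / 2 ^ cf_quot x 1"
proof -
  define y where "y = frac (1 / x)"
  define f where "f = (\<lambda>x n. if cf_rem x n = 0 then 0 else (- 1) ^ n / 2 ^ (cf_sum x (Suc n) - 1) :: real)"
  have y: "0 \<le> y" "y \<le> 1" by (auto simp: y_def less_imp_le[OF frac_lt_1])
  have a: "1 \<le> cf_quot x 1" using cf_quot_pos[of x 0] assms by simp
  have sy: "summable (f y)" unfolding f_def by (rule minkowski_qm_summable[OF y])
  have sx: "summable (f x)" unfolding f_def by (rule minkowski_qm_summable) (use assms in auto)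
  have S: "f x (Suc n) = - (1 / 2 ^ cf_quot x 1) * f y n" for n
  proof (cases "cf_rem y n = 0")
    case True
    then show ?thesis by (simp add: f_def y_def cf_rem_Suc_frac del: cf_rem.simps)
  next
    case False
    have "cf_sum x (Suc (Suc n)) = cf_quot x 1 + cf_sum y (Suc n)"
      by (simp add: cf_sum_eq sum.lessThan_Suc_shift[of _ "Suc n"] cf_quot_Suc_frac y_def
          del: sum.lessThan_Suc)
    moreover have "1 \<le> cf_sum y (Suc n)" using cf_sum_ge[OF y False] by simp
    ultimately have "cf_sum x (Suc (Suc n)) - 1 = cf_quot x 1 + (cf_sum y (Suc n) - 1)" by simp
    then show ?thesis using False
      by (simp add: f_def cf_rem_Suc_frac y_def[symmetric] power_add del: cf_rem.simps)
  qed
  have "minkowski_qm x = f x 0 + (\<Sum>n. f x (Suc n))"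
    using suminf_split_head[OF sx] by (simp add: minkowski_qm_def f_def)
  also have "(\<Sum>n. f x (Suc n)) = - (1 / 2 ^ cf_quot x 1) * (\<Sum>n. f y n)"
    unfolding S by (rule suminf_mult[OF sy])
  also have "(\<Sum>n. f y n) = minkowski_qm y" by (simp add: minkowski_qm_def f_def)
  also have "f x 0 = 2 / 2 ^ cf_quot x 1"
    using assms a by (simp add: f_def cf_sum_def power_diff)
  finally show ?thesis by (simp add: y_def diff_divide_distrib)
qed

lemma cf_rem_zero: "cf_rem 0 n = 0"
  by (induction n) auto

lemma qm_0: "minkowski_qm 0 = 0"
  by (simp add: minkowski_qm_def cf_rem_zero)

text \<open>
  The series is dominated by a geometric one with sum 2; fed into the functional equation, the
  upper bound 2 gives nonnegativity, and nonnegativity gives the upper bound 1.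
\<close>

lemma qm_bounds:
  assumes "0 \<le> x" "x \<le> 1"
  shows "0 \<le> minkowski_qm x" "minkowski_qm x \<le> 1"
proof -
  have le2: "minkowski_qm x \<le> 2" if "0 \<le> x" "x \<le> 1" for x
  proof -
    define f where "f = (\<lambda>n. if cf_rem x n = 0 then 0 else (- 1) ^ n / 2 ^ (cf_sum x (Suc n) - 1) :: real)"
    have "f n \<le> (1 / 2) ^ n" for n
    proof (cases "cf_rem x n = 0")
      case False
      have "(2::real) ^ n \<le> 2 ^ (cf_sum x (Suc n) - 1)"
        using cf_sum_ge[OF that False] by (intro power_increasing) auto
      moreover have "(- 1) ^ n \<le> (1::real)" by (cases "even n") auto
      ultimately show ?thesis
        using False by (simp add: f_def power_one_over frac_le)
    qed (simp add: f_def)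
    then have "suminf f \<le> (\<Sum>n. (1 / 2) ^ n)"
      by (intro suminf_le) (auto simp: f_def minkowski_qm_summable[OF that] intro!: summable_geometric)
    also have "\<dots> = 2" by (simp add: suminf_geometric)
    finally show ?thesis by (simp add: f_def minkowski_qm_def)
  qed
  have ge0: "0 \<le> minkowski_qm x" if "0 \<le> x" "x \<le> 1" for x
  proof (cases "x = 0")
    case True
    then show ?thesis by (simp add: qm_0)
  next
    case False
    then show ?thesis using qm_step[of x] le2[of "frac (1/x)"] that
      by (simp add: less_imp_le[OF frac_lt_1])
  qed
  show "0 \<le> minkowski_qm x" using ge0 assms .
  show "minkowski_qm x \<le> 1"
  proof (cases "x = 0")
    case True
    then show ?thesis by (simp add: qm_0)
  next
    case False
    have "2 ^ 1 \<le> (2::real) ^ cf_quot x 1"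
      using cf_quot_pos[of x 0] assms False by (intro power_increasing) auto
    then have "2 - minkowski_qm (frac (1/x)) \<le> 2 ^ cf_quot x 1"
      using ge0[of "frac (1/x)"] by (simp add: less_imp_le[OF frac_lt_1])
    then show ?thesis using qm_step[of x] assms False by simp
  qed
qed

lemma recip_cf:
  assumes "a \<ge> 1" "0 \<le> \<theta>" "\<theta> < 1"
  defines "x \<equiv> 1 / (real a + \<theta>)"
  shows "0 < x" "x \<le> 1" "cf_quot x 1 = a" "frac (1 / x) = \<theta>"
    "minkowski_qm x = (2 - minkowski_qm \<theta>) / 2 ^ a"
proof -
  show x: "0 < x" "x \<le> 1" using assms by (auto simp: field_simps)
  have e: "1 / x = real a + \<theta>" using assms by simp
  have fl: "\<lfloor>1 / x\<rfloor> = int a" unfolding e using assms by linarith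
  show q: "cf_quot x 1 = a" using fl by (simp add: cf_quot_def)
  show f: "frac (1 / x) = \<theta>" using fl by (simp add: frac_def e)
  show "minkowski_qm x = (2 - minkowski_qm \<theta>) / 2 ^ a" using qm_step[OF x] q f by simp
qed

lemma recip_cf_cases:
  assumes "0 < x" "x \<le> 1"
  obtains a \<theta> where "a \<ge> 1" "0 \<le> \<theta>" "\<theta> < 1" "x = 1 / (real a + \<theta>)" "cf_quot x 1 = a" "frac (1 / x) = \<theta>"
proof
  show "cf_quot x 1 \<ge> 1" using cf_quot_pos[of x 0] assms by simp
  show "x = 1 / (real (cf_quot x 1) + frac (1 / x))" using cf_rem_rec[of x 0] assms by simp
qed (auto simp: frac_lt_1)

text \<open>
  If the first quotient of \<open>x\<close> is \<open>a\<close>, the value is at most \<open>2 / 2\<^sup>a\<close>, while \<open>x\<close> exceeds \<open>1 / (a + 1)\<close>.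
\<close>

lemma qm_le_double:
  assumes "0 \<le> x" "x \<le> 1" shows "minkowski_qm x \<le> 2 * x"
proof (cases "x = 0")
  case True then show ?thesis by (simp add: qm_0)
next
  case False
  then have "0 < x" using assms by simp
  then obtain a \<theta> where a: "a \<ge> 1" "0 \<le> \<theta>" "\<theta> < 1" "x = 1 / (real a + \<theta>)"
    using recip_cf_cases[of x] assms(2) by blast
  have "real a + 1 \<le> 2 ^ a" 
  proof -
    have "a + 1 \<le> 2 ^ a" using less_exp[of a] by linarith
    then have "real (a + 1) \<le> real (2 ^ a)" by (simp only: of_nat_le_iff)
    then show ?thesis by simp
  qed
  then have "real a + \<theta> \<le> 2 ^ a" using a by linarith
  then have "2 / 2 ^ a \<le> 2 / (real a + \<theta>)" using a(1,2) by (intro divide_left_mono) auto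
  then have "2 / 2 ^ a \<le> 2 * x" unfolding a(4) by simp
  moreover have "minkowski_qm x \<le> 2 / 2 ^ a"
    unfolding a(4) recip_cf(5)[OF a(1-3)] using qm_bounds(1)[of \<theta>] a(2,3)
    by (intro divide_right_mono) auto
  ultimately show ?thesis by linarith
qed

text \<open>
  The same at the other end of the interval: above \<open>1/2\<close> the first quotient is 1 and
  \<open>1 - ?(x) = ?(\<theta>) / 2\<close> for the remainder \<open>\<theta>\<close>, while
  \<open>1 - x = \<theta> / (1 + \<theta>)\<close>.
\<close>

lemma qm_compl_le_double:
  assumes "0 \<le> x" "x \<le> 1" shows "1 - minkowski_qm x \<le> 2 * (1 - x)"
proof (cases "x \<le> 1 / 2")
  case True then show ?thesis using qm_bounds[OF assms] by (simp add: algebra_simps)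
next
  case False
  then have "0 < x" by simp
  then obtain a \<theta> where a: "a \<ge> 1" "0 \<le> \<theta>" "\<theta> < 1" "x = 1 / (real a + \<theta>)"
    using recip_cf_cases[of x] assms(2) by blast
  have "a < 2"
  proof (rule ccontr)
    assume "\<not> a < 2"
    then have "x \<le> 1 / 2" unfolding a(4) using a by (intro divide_left_mono) auto
    then show False using False by simp
  qed
  then have "a = 1" using a by simp
  then have "1 - minkowski_qm x = minkowski_qm \<theta> / 2"
    using recip_cf(5)[OF a(1-3)] a(4) by (simp add: field_simps)
  also have "\<dots> \<le> \<theta>" using qm_le_double[of \<theta>] a by simp
  also have "\<theta> \<le> 2 * (1 - x)"
  proof -
    have "1 - x = \<theta> / (1 + \<theta>)" using a(2) unfolding a(4) \<open>a = 1\<close> by (simp add: field_simps)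
    moreover have "\<theta> / 2 \<le> \<theta> / (1 + \<theta>)" using a(2,3) by (intro divide_left_mono) auto
    ultimately show ?thesis by argo
  qed
  finally show ?thesis .
qed

lemma mult_Suc_le_pow2: "n \<ge> 1 \<Longrightarrow> real n * (real n + 1) \<le> 3 * 2 ^ (n - 1)"
proof (induction n rule: nat_induct_at_least)
  case base then show ?case by simp
next
  case (Suc n)
  show ?case
  proof (cases "n = 1")
    case False
    then have "(real n + 1) * (real n + 2) \<le> (real n + 1) * (2 * real n)"
      using Suc(1) by (intro mult_left_mono) auto
    then have "real (Suc n) * (real (Suc n) + 1) \<le> 2 * (real n * (real n + 1))"
      by (simp add: algebra_simps)
    also have "\<dots> \<le> 3 * 2 ^ (Suc n - 1)" using Suc by (cases n) auto
    finally show ?thesis .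
  qed simp
qed

lemma qm_recip: assumes "n \<ge> 1" shows "minkowski_qm (1 / real n) = 2 / 2 ^ n"
  using recip_cf(5)[of n 0] assms by (simp add: qm_0)

text \<open>
  Near \<open>1 / n\<close> the function is Lipschitz with a constant not depending on \<open>n\<close>: by the functional
  equation the difference quotient there is that at 0 (or at 1, on the other side) multiplied by
  a factor of order \<open>n\<^sup>2 / 2\<^sup>n\<close>, which is bounded.
\<close>

lemma qm_lipschitz_recip_left:
  assumes "a \<ge> 1" "0 \<le> \<theta>" "\<theta> < 1"
  shows "\<bar>minkowski_qm (1 / real a) - minkowski_qm (1 / (real a + \<theta>))\<bar> \<le> 6 * (1 / real a - 1 / (real a + \<theta>))"
proof -
  have "real a * (real a + \<theta>) \<le> real a * (real a + 1)" using assms by (intro mult_left_mono) auto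
  also have "\<dots> \<le> 3 * 2 ^ a" using mult_Suc_le_pow2[of a] assms(1) power_increasing[of "a - 1" a "2::real"] by linarith
  finally have k: "real a * (real a + \<theta>) \<le> 3 * 2 ^ a" .
  have "minkowski_qm (1 / real a) - minkowski_qm (1 / (real a + \<theta>)) = minkowski_qm \<theta> / 2 ^ a"
    using qm_recip[of a] recip_cf(5)[OF assms] assms by (simp add: field_simps)
  moreover have "0 \<le> minkowski_qm \<theta> / 2 ^ a" using qm_bounds[of \<theta>] assms by simp
  moreover have "minkowski_qm \<theta> / 2 ^ a \<le> 2 * \<theta> / 2 ^ a"
    using qm_le_double[of \<theta>] assms by (intro divide_right_mono) auto
  moreover have "2 * \<theta> / 2 ^ a \<le> 6 * \<theta> / (real a * (real a + \<theta>))"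
  proof -
    have "2 * \<theta> / 2 ^ a = 6 * \<theta> / (3 * 2 ^ a)" by simp
    also have "\<dots> \<le> 6 * \<theta> / (real a * (real a + \<theta>))"
    proof (rule divide_left_mono[OF k])
      show "0 < 3 * 2 ^ a * (real a * (real a + \<theta>))" using assms by simp
    qed (use assms in simp)
    finally show ?thesis .
  qed
  moreover have "6 * (1 / real a - 1 / (real a + \<theta>)) = 6 * \<theta> / (real a * (real a + \<theta>))"
    using assms by (simp add: field_simps)
  ultimately show ?thesis by argo
qed

lemma qm_lipschitz_recip_right:
  assumes "a \<ge> 1" "0 \<le> \<theta>" "\<theta> < 1"
  shows "\<bar>minkowski_qm (1 / (real a + \<theta>)) - minkowski_qm (1 / real (Suc a))\<bar>
      \<le> 6 * (1 / (real a + \<theta>) - 1 / real (Suc a))"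
proof -
  have "(real a + \<theta>) * (real a + 1) \<le> (real a + 1) * (real a + 2)" using assms by (intro mult_mono) auto
  also have "\<dots> \<le> 3 * 2 ^ a" using mult_Suc_le_pow2[of "Suc a"] by (simp add: algebra_simps)
  finally have k: "(real a + \<theta>) * (real a + 1) \<le> 3 * 2 ^ a" .
  have "minkowski_qm (1 / (real a + \<theta>)) - minkowski_qm (1 / real (Suc a)) = (1 - minkowski_qm \<theta>) / 2 ^ a"
    using qm_recip[of "Suc a"] recip_cf(5)[OF assms] assms by (simp add: field_simps)
  moreover have "0 \<le> (1 - minkowski_qm \<theta>) / 2 ^ a" using qm_bounds[of \<theta>] assms by simp
  moreover have "(1 - minkowski_qm \<theta>) / 2 ^ a \<le> 2 * (1 - \<theta>) / 2 ^ a"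
    using qm_compl_le_double[of \<theta>] assms by (intro divide_right_mono) auto
  moreover have "2 * (1 - \<theta>) / 2 ^ a \<le> 6 * (1 - \<theta>) / ((real a + \<theta>) * (real a + 1))"
  proof -
    have "2 * (1 - \<theta>) / 2 ^ a = 6 * (1 - \<theta>) / (3 * 2 ^ a)" by (simp add: field_simps)
    also have "\<dots> \<le> 6 * (1 - \<theta>) / ((real a + \<theta>) * (real a + 1))"
    proof (rule divide_left_mono[OF k])
      show "0 < 3 * 2 ^ a * ((real a + \<theta>) * (real a + 1))" using assms by simp
    qed (use assms in simp)
    finally show ?thesis .
  qed
  moreover have "6 * (1 / (real a + \<theta>) - 1 / real (Suc a)) = 6 * (1 - \<theta>) / ((real a + \<theta>) * (real a + 1))"
    using assms by (simp add: field_simps)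
  ultimately show ?thesis by argo
qed

lemma qm_lipschitz_recip_recip:
  assumes "1 \<le> c" "c \<le> b"
  shows "\<bar>minkowski_qm (1 / real c) - minkowski_qm (1 / real b)\<bar> \<le> 6 * (1 / real c - 1 / real b)"
proof (cases "c = b")
  case False
  then have "c + 1 \<le> b" using assms by auto
  have "1 / real b \<le> 1 / (real c + 1)" using \<open>c + 1 \<le> b\<close> by (simp add: frac_le)
  moreover have "1 / real c - 1 / (real c + 1) = 1 / (real c * (real c + 1))"
    using assms by (simp add: field_simps)
  ultimately have "1 / (real c * (real c + 1)) \<le> 1 / real c - 1 / real b" by linarith
  moreover have "2 / 2 ^ c \<le> 6 * (1 / (real c * (real c + 1)))"
  proof -
    have e: "3 * 2 ^ (c - 1) = 3 / 2 * (2::real) ^ c" using assms by (cases c) auto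
    have "6 / (3 / 2 * (2::real) ^ c) \<le> 6 / (real c * (real c + 1))"
    proof (rule divide_left_mono)
      show "real c * (real c + 1) \<le> 3 / 2 * 2 ^ c" using mult_Suc_le_pow2[of c] assms unfolding e by blast
      show "0 < 3 / 2 * 2 ^ c * (real c * (real c + 1))" using assms by simp
    qed simp
    moreover have "6 / (3 / 2 * (2::real) ^ c) = 4 / 2 ^ c" by simp
    moreover have "2 / (2::real) ^ c \<le> 4 / 2 ^ c" by (intro divide_right_mono) auto
    ultimately show ?thesis by argo
  qed
  moreover have "(2::real) / 2 ^ b \<le> 2 / 2 ^ c" using assms by (simp add: frac_le)
  moreover have "0 \<le> 2 / (2::real) ^ b" by simp
  ultimately have "\<bar>2 / 2 ^ c - 2 / 2 ^ b\<bar> \<le> 6 * (1 / real c - 1 / real b)" by argo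
  then show ?thesis using qm_recip[of c] qm_recip[of b] assms by simp
qed simp

text \<open>
  Two points whose first quotients \<open>a < b\<close> differ are separated by \<open>1 / (a + 1) \<ge> 1 / b\<close>, and the
  uniform Lipschitz bounds at reciprocals chain along these two points. The value \<open>y = 0\<close> plays
  the part of an infinite first quotient.
\<close>

lemma qm_lipschitz_distinct_quot:
  assumes "0 < x" "x \<le> 1" "0 \<le> y" "y \<le> 1" "y = 0 \<or> cf_quot x 1 \<noteq> cf_quot y 1"
  shows "\<bar>minkowski_qm x - minkowski_qm y\<bar> \<le> 6 * \<bar>x - y\<bar>"
proof (cases "y = 0")
  case True
  then show ?thesis using qm_le_double[of x] qm_bounds[of x] assms by (simp add: qm_0)
next
  case False
  have main: "\<bar>minkowski_qm x - minkowski_qm y\<bar> \<le> 6 * \<bar>x - y\<bar>"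
    if x: "0 < x" "x \<le> 1" and y: "0 < y" "y \<le> 1" and lt: "cf_quot x 1 < cf_quot y 1" for x y
  proof -
    obtain a \<alpha> where a: "a \<ge> 1" "0 \<le> \<alpha>" "\<alpha> < 1" "x = 1 / (real a + \<alpha>)" "cf_quot x 1 = a"
      using recip_cf_cases[OF x] by metis
    obtain b \<beta> where b: "b \<ge> 1" "0 \<le> \<beta>" "\<beta> < 1" "y = 1 / (real b + \<beta>)" "cf_quot y 1 = b"
      using recip_cf_cases[OF y] by metis
    have ab: "1 \<le> Suc a" "Suc a \<le> b" using lt a b by auto
    have chain: "\<bar>p - s\<bar> \<le> 6 * \<bar>u - v\<bar>"
      if "\<bar>p - q\<bar> \<le> 6 * (u - w)" "\<bar>q - r\<bar> \<le> 6 * (w - w')" "\<bar>r - s\<bar> \<le> 6 * (w' - v)"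
      for p q r s u v w w' :: real using that by argo
    show ?thesis
      using chain[OF qm_lipschitz_recip_right[OF a(1-3)] qm_lipschitz_recip_recip[OF ab]
        qm_lipschitz_recip_left[OF b(1-3)]] unfolding a(4) b(4) .
  qed
  show ?thesis
  proof (cases "cf_quot x 1 < cf_quot y 1")
    case True then show ?thesis using main[of x y] assms False by auto
  next
    case F: False then show ?thesis
      using main[of y x] assms False by (simp add: abs_minus_commute)
  qed
qed

section \<open>Denominators of convergents and points with a common prefix\<close>

text \<open>
  The sequence is indexed from 0, so that \<open>a k\<close> is the partial quotient number \<open>k + 1\<close>.
\<close>

fun cf_den :: "(nat \<Rightarrow> nat) \<Rightarrow> nat \<Rightarrow> real" where
  "cf_den a 0 = 1"
| "cf_den a (Suc 0) = real (a 0)"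
| "cf_den a (Suc (Suc n)) = real (a (Suc n)) * cf_den a (Suc n) + cf_den a n"

lemma golden_mult: "golden * golden = golden + 1"
  by (simp add: golden_def field_simps)

lemma golden_bounds: "1 < golden" "golden \<le> 2" "2 < golden * golden" "golden * golden \<le> 3"
proof -
  show g: "1 < golden" by (simp add: golden_def)
  have "sqrt 5 \<le> sqrt (3^2)" by (subst real_sqrt_le_iff) simp
  then show "golden \<le> 2" by (simp add: golden_def)
  then show "golden * golden \<le> 3" "2 < golden * golden" unfolding golden_mult using g by auto
qed

lemmas golden_gt_1 = golden_bounds(1)

lemma cf_den_cong:
  "(\<And>k. k < n \<Longrightarrow> a k = b k) \<Longrightarrow> cf_den a n = cf_den b n"
  by (induction a n rule: cf_den.induct) auto

lemma cf_den_ge_1: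
  assumes "\<And>k. a k \<ge> 1" shows "1 \<le> cf_den a n"
  using assms
proof (induction a n rule: cf_den.induct)
  case (2 a)
  then show ?case by (simp add: Suc_le_eq)
next
  case (3 a n)
  have "0 \<le> real (a (Suc n)) * cf_den a (Suc n)" 
    using "3.IH"(1)[OF "3.prems"] by simp
  then show ?case using "3.IH"(2)[OF "3.prems"] by simp
qed simp

lemma cf_den_Suc_ge:
  assumes "\<And>k. a k \<ge> 1" shows "cf_den a n \<le> cf_den a (Suc n)"
proof (cases n)
  case 0
  then show ?thesis using assms[of 0] by simp
next
  case (Suc m)
  have "1 * cf_den a (Suc m) \<le> real (a (Suc m)) * cf_den a (Suc m)"
    using assms[of "Suc m"] cf_den_ge_1[of a "Suc m", OF assms] by (intro mult_right_mono) auto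
  then show ?thesis using Suc cf_den_ge_1[of a m, OF assms] by simp
qed

text \<open>
  Against the Fibonacci growth of the case \<open>a = 1\<close>, a quotient \<open>a\<close> costs at most a factor \<open>a\<close>.
\<close>

lemma cf_den_upper:
  assumes "\<And>k. a k \<ge> 1" shows "cf_den a n \<le> golden ^ n * (\<Prod>k<n. real (a k))"
  using assms
proof (induction a n rule: cf_den.induct)
  case (2 a)
  then show ?case using golden_gt_1 mult_right_mono[of 1 golden "real (a 0)"] by simp
next
  case (3 a n)
  define P where "P = (\<Prod>k<n. real (a k))"
  define b c where "b = real (a n)" and "c = real (a (Suc n))"
  have bc: "1 \<le> b" "1 \<le> c" using "3.prems"[of n] "3.prems"[of "Suc n"] by (auto simp: b_def c_def)
  have P: "0 \<le> P" by (simp add: P_def prod_nonneg)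
  have "1 * 1 \<le> b * c" using bc by (intro mult_mono) auto
  then have "golden ^ n * P \<le> golden ^ n * (P * (b * c))"
    using P golden_gt_1 mult_left_mono[of 1 "b * c" P] by (intro mult_left_mono) auto
  then have 1: "cf_den a n \<le> golden ^ n * (P * (b * c))"
    using "3.IH"(2)[OF "3.prems"] by (simp add: P_def)
  have "c * cf_den a (Suc n) \<le> c * (golden ^ Suc n * (P * b))"
    using "3.IH"(1)[OF "3.prems"] bc by (intro mult_left_mono) (auto simp: P_def b_def)
  then have "cf_den a (Suc (Suc n)) \<le> c * (golden ^ Suc n * (P * b)) + golden ^ n * (P * (b * c))"
    using 1 by (simp add: c_def)
  also have "\<dots> = golden ^ n * (golden + 1) * (P * b * c)" by (simp add: algebra_simps)
  also have "\<dots> = golden ^ Suc (Suc n) * (P * b * c)"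
    unfolding golden_mult[symmetric] by simp
  finally show ?case by (simp add: P_def b_def c_def)
qed simp

text \<open>
  Follow \<open>v\<^sub>n = q\<^sub>n\<^sub>+\<^sub>1 + q\<^sub>n / \<Phi>\<close>, the component of \<open>(q\<^sub>n\<^sub>+\<^sub>1, q\<^sub>n)\<close> along the dominant eigenvector of the
  step with quotient 1. A quotient \<open>a\<close> multiplies it by at least \<open>\<Phi> (1 + (a - 1) / \<Phi>\<^sup>2)\<close>, and
  \<open>\<Phi>\<^sup>2 \<le> 3\<close>. The factor \<open>(a + 2) / 3\<close> is 1 for \<open>a = 1\<close> and of order \<open>a\<close> for large \<open>a\<close>, which is
  all that the asymptotics need.
\<close>

lemma cf_den_lower:
  assumes a: "\<And>k. a k \<ge> 1"
  shows "golden ^ n * (\<Prod>k<n. (real (a k) + 2) / 3) \<le> golden * cf_den a n"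
proof -
  \<comment> \<open>Here \<open>golden - 1 = 1 / golden\<close>; the step with quotient \<open>1\<close> multiplies \<open>v\<close> exactly by \<open>golden\<close>.\<close>
  define v where "v n = cf_den a (Suc n) + (golden - 1) * cf_den a n" for n
  have vq: "v n \<le> golden * cf_den a (Suc n)" for n
    using mult_left_mono[OF cf_den_Suc_ge[of a n, OF a], of "golden - 1"] golden_gt_1
    by (simp add: v_def algebra_simps)
  have main: "golden ^ Suc n * (\<Prod>k<Suc n. (real (a k) + 2) / 3) \<le> v n" for n
  proof (induction n)
    case 0
    have "golden * (real (a 0) - 1) \<le> 3 * (real (a 0) - 1)"
      using a[of 0] golden_bounds by (intro mult_right_mono) auto
    then show ?case by (simp add: v_def field_simps)
  next
    case (Suc n)
    define c where "c = real (a (Suc n))"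
    have c: "1 \<le> c" using a[of "Suc n"] by (simp add: c_def)
    have v0: "0 \<le> v n" using cf_den_ge_1[of a n, OF a] cf_den_ge_1[of a "Suc n", OF a] golden_gt_1
      by (simp add: v_def)
    have "golden * ((c + 2) / 3 * v n) = golden * v n + (c - 1) * (golden / 3 * v n)"
      by (simp add: field_simps)
    also have "golden / 3 * v n \<le> cf_den a (Suc n)"
    proof -
      have "golden / 3 * v n \<le> golden / 3 * (golden * cf_den a (Suc n))"
        using vq golden_gt_1 by (intro mult_left_mono) auto
      also have "\<dots> = (golden * golden) / 3 * cf_den a (Suc n)" by simp
      also have "\<dots> \<le> 1 * cf_den a (Suc n)"
        using golden_bounds cf_den_ge_1[of a "Suc n", OF a] by (intro mult_right_mono) auto
      finally show ?thesis by simp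
    qed
    then have "golden * v n + (c - 1) * (golden / 3 * v n) \<le> golden * v n + (c - 1) * cf_den a (Suc n)"
      using c by (intro add_left_mono mult_left_mono) auto
    also have "\<dots> = (golden * golden - 1 - golden) * cf_den a n + v (Suc n)"
      by (simp add: v_def c_def algebra_simps)
    also have "\<dots> = v (Suc n)" by (simp add: golden_mult)
    finally have *: "golden * ((c + 2) / 3 * v n) \<le> v (Suc n)" .
    have "golden ^ Suc (Suc n) * (\<Prod>k<Suc (Suc n). (real (a k) + 2) / 3)
        = golden * ((c + 2) / 3 * (golden ^ Suc n * (\<Prod>k<Suc n. (real (a k) + 2) / 3)))"
      by (simp add: c_def)
    also have "\<dots> \<le> golden * ((c + 2) / 3 * v n)"
      using Suc golden_gt_1 c by (intro mult_left_mono) auto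
    finally show ?case using * by linarith
  qed
  show ?thesis
  proof (cases n)
    case 0
    then show ?thesis using golden_gt_1 by simp
  next
    case (Suc m)
    then show ?thesis using main[of m] vq[of m] by simp
  qed
qed

text \<open>
  The product of the remainders stands in for the convergents: it equals \<open>1 / (q\<^sub>t + x\<^sub>t q\<^sub>t\<^sub>-\<^sub>1)\<close>, so no
  numerators are needed.
\<close>

lemma cf_rem_prod_eq:
  assumes "0 \<le> x" "x \<le> 1" "\<And>k. k \<le> t \<Longrightarrow> cf_rem x k \<noteq> 0"
  shows "1 / (\<Prod>k<Suc t. cf_rem x k)
    = cf_den (\<lambda>k. cf_quot x (Suc k)) (Suc t) + cf_rem x (Suc t) * cf_den (\<lambda>k. cf_quot x (Suc k)) t"
  using assms(3)
proof (induction t)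
  case 0
  have "x = 1 / (real (cf_quot x 1) + cf_rem x 1)"
    using cf_rem_rec[OF assms(1,2), of 0] 0 by simp
  then have "1 / x = real (cf_quot x 1) + cf_rem x 1" by (metis div_by_1 divide_divide_eq_right mult_1)
  then show ?case by simp
next
  case (Suc t)
  let ?q = "cf_den (\<lambda>k. cf_quot x (Suc k))"
  define P where "P = (\<Prod>k<Suc t. cf_rem x k)"
  define r where "r = cf_rem x (Suc t)"
  define s where "s = cf_rem x (Suc (Suc t))"
  define c where "c = real (cf_quot x (Suc (Suc t)))"
  have r: "r \<noteq> 0" unfolding r_def using Suc.prems by blast
  have "r = 1 / (c + s)" unfolding r_def c_def s_def
    using cf_rem_rec[OF assms(1,2), of "Suc t"] Suc.prems by blast
  then have i: "1 / r = c + s" by simp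
  have IH: "1 / P = ?q (Suc t) + r * ?q t" unfolding P_def r_def using Suc by simp
  have "1 / (P * r) = (?q (Suc t) + r * ?q t) * (1 / r)" unfolding IH[symmetric] by simp
  also have "\<dots> = ?q (Suc t) * (1 / r) + ?q t" using r by (simp add: field_simps)
  also have "\<dots> = ?q (Suc t) * (c + s) + ?q t" unfolding i ..
  also have "\<dots> = ?q (Suc (Suc t)) + s * ?q (Suc t)"
    by (simp add: c_def algebra_simps)
  finally show ?case by (simp add: P_def r_def s_def prod.lessThan_Suc[of _ "Suc t"] del: prod.lessThan_Suc cf_rem.simps cf_den.simps)
qed

text \<open>
  The hypothesis \<open>a k \<ge> 1\<close> for all \<open>k\<close> lets the lemma also speak of a point \<open>y\<close> whose own expansion
  may stop after \<open>t\<close> steps: its first quotients are taken from the sequence \<open>a\<close> of a nearby irrational.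
\<close>

lemma cf_rem_prod_bounds:
  assumes x: "0 \<le> x" "x \<le> 1" and nz: "\<And>k. k < t \<Longrightarrow> cf_rem x k \<noteq> 0"
    and a: "\<And>k. a k \<ge> 1" and eq: "\<And>k. k < t \<Longrightarrow> cf_quot x (Suc k) = a k"
  shows "1 / (2 * cf_den a t) \<le> (\<Prod>k<t. cf_rem x k)" "(\<Prod>k<t. cf_rem x k) \<le> 1 / cf_den a t"
proof -
  define P where "P = (\<Prod>k<t. cf_rem x k)"
  have P: "0 < P" unfolding P_def
    using nz cf_rem_bounds[OF x] by (intro prod_pos) (auto simp: order.strict_iff_order)
  have q: "1 \<le> cf_den a t" by (rule cf_den_ge_1[of a, OF a])
  have "cf_den a t \<le> 1 / P \<and> 1 / P \<le> 2 * cf_den a t"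
  proof (cases t)
    case 0
    then show ?thesis by (simp add: P_def)
  next
    case (Suc s)
    have c1: "cf_den (\<lambda>k. cf_quot x (Suc k)) t = cf_den a t"
      by (rule cf_den_cong) (use eq in auto)
    have c2: "cf_den (\<lambda>k. cf_quot x (Suc k)) s = cf_den a s"
      by (rule cf_den_cong) (use eq Suc in auto)
    have e: "1 / P = cf_den a t + cf_rem x t * cf_den a s"
      using cf_rem_prod_eq[OF x, of s] nz c1 c2 Suc unfolding P_def by auto
    have "0 \<le> cf_rem x t * cf_den a s"
      using cf_rem_bounds[OF x, of t] cf_den_ge_1[of a s, OF a] by simp
    moreover have "cf_rem x t * cf_den a s \<le> 1 * cf_den a t"
      using cf_rem_bounds[OF x, of t] cf_den_ge_1[of a s, OF a] cf_den_Suc_ge[of a s, OF a] Suc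
      by (intro mult_mono) auto
    ultimately show ?thesis using e by simp
  qed
  then have "cf_den a t \<le> 1 / P" "1 / P \<le> 2 * cf_den a t" by auto
  then show "1 / (2 * cf_den a t) \<le> (\<Prod>k<t. cf_rem x k)" "(\<Prod>k<t. cf_rem x k) \<le> 1 / cf_den a t"
    using P q unfolding P_def[symmetric] by (auto simp: field_simps)
qed

text \<open>
  Each step \<open>x = 1 / (a + x')\<close> contracts a distance by \<open>x y\<close>.
\<close>

lemma common_prefix_dist:
  assumes x: "0 \<le> x" "x \<le> 1" and y: "0 \<le> y" "y \<le> 1"
    and nz: "\<And>k. k < t \<Longrightarrow> cf_rem x k \<noteq> 0" "\<And>k. k < t \<Longrightarrow> cf_rem y k \<noteq> 0"
    and eq: "\<And>k. k < t \<Longrightarrow> cf_quot y (Suc k) = cf_quot x (Suc k)"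
  shows "\<bar>x - y\<bar> = \<bar>cf_rem x t - cf_rem y t\<bar> * ((\<Prod>k<t. cf_rem x k) * (\<Prod>k<t. cf_rem y k))"
  using nz eq
proof (induction t)
  case (Suc t)
  define c where "c = real (cf_quot x (Suc t))"
  define r s r' s' where "r = cf_rem x t" and "s = cf_rem y t"
    and "r' = cf_rem x (Suc t)" and "s' = cf_rem y (Suc t)"
  have rs: "r \<noteq> 0" "s \<noteq> 0" using Suc.prems by (auto simp: r_def s_def)
  have e: "1 / r = c + r'" "1 / s = c + s'"
    using cf_rem_rec[OF x, of t] cf_rem_rec[OF y, of t] Suc.prems
    by (auto simp: r_def s_def r'_def s'_def c_def simp del: cf_rem.simps)
  have "r - s = (1 / s - 1 / r) * (r * s)" using rs by (simp add: field_simps)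
  also have "\<dots> = (s' - r') * (r * s)" unfolding e by simp
  finally have "\<bar>r - s\<bar> = \<bar>r' - s'\<bar> * (\<bar>r\<bar> * \<bar>s\<bar>)" by (simp add: abs_mult abs_minus_commute)
  also have "\<bar>r\<bar> = r" using cf_rem_bounds[OF x, of t] by (simp add: r_def)
  also have "\<bar>s\<bar> = s" using cf_rem_bounds[OF y, of t] by (simp add: s_def)
  finally show ?case using Suc by (simp add: r_def s_def r'_def s'_def del: cf_rem.simps)
qed simp

text \<open>
  In contrast, each step halves the distance of the values \<open>a\<close> times. The quotient of both
  effects, \<open>q\<^sub>t\<^sup>2 / 2 ^ S\<^sub>t\<close> up to bounded factors, governs the derivative.
\<close>

lemma common_prefix_qm_dist:
  assumes x: "0 \<le> x" "x \<le> 1" and y: "0 \<le> y" "y \<le> 1"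
    and nz: "\<And>k. k < t \<Longrightarrow> cf_rem x k \<noteq> 0" "\<And>k. k < t \<Longrightarrow> cf_rem y k \<noteq> 0"
    and eq: "\<And>k. k < t \<Longrightarrow> cf_quot y (Suc k) = cf_quot x (Suc k)"
  shows "\<bar>minkowski_qm x - minkowski_qm y\<bar>
    = \<bar>minkowski_qm (cf_rem x t) - minkowski_qm (cf_rem y t)\<bar> / 2 ^ cf_sum x t"
  using nz eq
proof (induction t)
  case 0
  then show ?case by (simp add: cf_sum_eq)
next
  case (Suc t)
  have step: "minkowski_qm (cf_rem z t)
      = (2 - minkowski_qm (cf_rem z (Suc t))) / 2 ^ cf_quot z (Suc t)"
    if "0 \<le> z" "z \<le> 1" "cf_rem z t \<noteq> 0" for z
    using qm_step[of "cf_rem z t"] cf_rem_bounds[OF that(1,2), of t] that(3) cf_quot_rem[of z t]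
    by simp
  have "minkowski_qm (cf_rem x t) - minkowski_qm (cf_rem y t)
      = (minkowski_qm (cf_rem y (Suc t)) - minkowski_qm (cf_rem x (Suc t))) / 2 ^ cf_quot x (Suc t)"
    using step[OF x] step[OF y] Suc.prems by (simp add: diff_divide_distrib del: cf_rem.simps)
  then show ?case using Suc
    by (simp add: cf_sum_eq power_add abs_minus_commute mult.commute del: cf_rem.simps)
qed

section \<open>Vanishing derivative in terms of denominators\<close>

lemma cf_rem_0_1:
  assumes "0 < x" "x < 1" "x \<notin> \<rat>"
  shows "0 < cf_rem x n" "cf_rem x n < 1" "cf_quot x (Suc n) \<ge> 1"
proof -
  have i: "cf_rem x n \<notin> \<rat>" by (rule cf_rem_irrational[OF assms(3)])
  then have "cf_rem x n \<noteq> 0" "cf_rem x n \<noteq> 1" by auto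
  then show "0 < cf_rem x n" "cf_rem x n < 1" "cf_quot x (Suc n) \<ge> 1"
    using cf_rem_bounds[of x n] cf_quot_pos[of x n] assms by auto
qed

lemma ex_same_prefix:
  assumes "0 < \<theta>" "\<theta> < 1" "\<And>k. a k \<ge> 1"
  shows "\<exists>y. 0 < y \<and> y < 1 \<and> cf_rem y t = \<theta> \<and> (\<forall>k<t. cf_rem y k \<noteq> 0 \<and> cf_quot y (Suc k) = a k)"
  using assms(3)
proof (induction t arbitrary: a)
  case 0
  then show ?case using assms by auto
next
  case (Suc t)
  obtain z where z: "0 < z" "z < 1" "cf_rem z t = \<theta>"
    "\<And>k. k < t \<Longrightarrow> cf_rem z k \<noteq> 0 \<and> cf_quot z (Suc k) = a (Suc k)"
    using Suc.IH[of "\<lambda>k. a (Suc k)"] Suc.prems by blast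
  define y where "y = 1 / (real (a 0) + z)"
  have r: "0 < y" "cf_quot y 1 = a 0" "frac (1 / y) = z"
    using recip_cf[of "a 0" z] z Suc.prems[of 0] by (auto simp: y_def)
  have "y < 1" using z(1) Suc.prems[of 0] by (simp add: y_def)
  moreover have "cf_rem y (Suc t) = \<theta>" using z(3) r(3) by (simp add: cf_rem_Suc_frac del: cf_rem.simps)
  moreover have "cf_rem y k \<noteq> 0 \<and> cf_quot y (Suc k) = a k" if "k < Suc t" for k
  proof (cases k)
    case 0
    then show ?thesis using r by simp
  next
    case (Suc j)
    then show ?thesis using z(4)[of j] that r(3) cf_quot_Suc_frac[of "Suc j" y]
      by (simp add: cf_rem_Suc_frac del: cf_rem.simps)
  qed
  ultimately show ?case using r(1) by blast
qed

lemma cf_den_at_top: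
  assumes a: "\<And>k. a k \<ge> 1"
  shows "filterlim (cf_den a) at_top sequentially"
  unfolding filterlim_at_top_dense
proof
  fix c :: real
  have le: "golden ^ t \<le> 2 * cf_den a t" for t
  proof -
    have "1 \<le> (\<Prod>k<t. (real (a k) + 2) / 3)" using a by (intro prod_ge_1) (auto simp: Suc_le_eq)
    then have "golden ^ t * 1 \<le> golden ^ t * (\<Prod>k<t. (real (a k) + 2) / 3)"
      using golden_gt_1 by (intro mult_left_mono) auto
    also have "\<dots> \<le> golden * cf_den a t" by (rule cf_den_lower[OF a])
    also have "\<dots> \<le> 2 * cf_den a t"
      using golden_bounds cf_den_ge_1[of a t, OF a] by (intro mult_right_mono) auto
    finally show ?thesis by simp
  qed
  obtain T where T: "2 * c < golden ^ T" using real_arch_pow[OF golden_gt_1] by blast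
  show "\<forall>\<^sub>F t in sequentially. c < cf_den a t"
    unfolding eventually_sequentially
  proof (intro exI[of _ T] allI impI)
    fix t assume "T \<le> t"
    then have "golden ^ T \<le> golden ^ t" using golden_gt_1 by (intro power_increasing) auto
    then show "c < cf_den a t" using T le[of t] by linarith
  qed
qed

text \<open>
  Compare \<open>x\<close> with a point \<open>y\<close> that shares its first \<open>t\<close> quotients but has a remainder with a
  different value. The difference quotient is then at least \<open>q\<^sub>t\<^sup>2 / (8 * 2 ^ S\<^sub>t)\<close>, and \<open>y\<close> tends to
  \<open>x\<close> as \<open>t\<close> grows, so this is eventually below 1.
\<close>

lemma deriv_0_imp_den_bound:
  assumes x: "0 < x" "x < 1" "x \<notin> \<rat>"
    and d: "(minkowski_qm has_real_derivative 0) (at x)"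
  defines "a \<equiv> \<lambda>k. cf_quot x (Suc k)"
  shows "\<forall>\<^sub>F t in sequentially. (cf_den a t)\<^sup>2 \<le> 8 * 2 ^ cf_sum x t"
proof -
  have a: "a k \<ge> 1" for k using cf_rem_0_1[OF x] by (simp add: a_def)
  obtain \<delta> where \<delta>: "\<delta> > 0"
    "\<And>y. y \<noteq> x \<Longrightarrow> \<bar>y - x\<bar> < \<delta> \<Longrightarrow> \<bar>(minkowski_qm y - minkowski_qm x) / (y - x)\<bar> < 1"
  proof -
    have "((\<lambda>y. (minkowski_qm y - minkowski_qm x) / (y - x)) \<longlongrightarrow> 0) (at x)"
      using d by (simp add: has_field_derivative_iff)
    from LIM_D[OF this, of 1] show ?thesis using that by auto
  qed
  have "\<forall>\<^sub>F t in sequentially. 1 / \<delta> < cf_den a t"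
    using cf_den_at_top[of a, OF a] by (simp add: filterlim_at_top_dense)
  then show ?thesis
  proof (rule eventually_mono)
    fix t assume t: "1 / \<delta> < cf_den a t"
    define \<theta> where "\<theta> = cf_rem x t"
    \<comment> \<open>The values at \<open>1/2\<close> and \<open>1/3\<close> differ by \<open>1/4\<close>, so one of them is far from the value at \<open>\<theta>\<close>.
      Zero would end the expansion of \<open>y\<close> too early when its last quotient is \<open>1\<close>.\<close>
    obtain \<theta>' where th': "0 < \<theta>'" "\<theta>' < 1" "1 / 8 \<le> \<bar>minkowski_qm \<theta> - minkowski_qm \<theta>'\<bar>"
    proof -
      have "minkowski_qm (1 / 2) = 1 / 2" "minkowski_qm (1 / 3) = 1 / 4"
        using qm_recip[of 2] qm_recip[of 3] by auto
      then have "1 / 8 \<le> \<bar>minkowski_qm \<theta> - minkowski_qm (1/2)\<bar> \<or> 1 / 8 \<le> \<bar>minkowski_qm \<theta> - minkowski_qm (1/3)\<bar>"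
        by argo
      then show ?thesis using that[of "1/2"] that[of "1/3"] by auto
    qed
    obtain y where y: "0 < y" "y < 1" "cf_rem y t = \<theta>'"
      "\<And>k. k < t \<Longrightarrow> cf_rem y k \<noteq> 0 \<and> cf_quot y (Suc k) = a k"
      using ex_same_prefix[of \<theta>' a t, OF th'(1,2) a] by auto
    have nzx: "cf_rem x k \<noteq> 0" for k using cf_rem_0_1[OF x, of k] by simp
    define X Y where "X = (\<Prod>k<t. cf_rem x k)" and "Y = (\<Prod>k<t. cf_rem y k)"
    define q where "q = cf_den a t"
    have q: "1 \<le> q" unfolding q_def by (rule cf_den_ge_1[OF a])
    have X: "X \<le> 1 / q" unfolding X_def q_def
      by (rule cf_rem_prod_bounds(2)[of x t a]) (use x nzx a in \<open>auto simp: a_def\<close>)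
    have Y: "Y \<le> 1 / q" unfolding Y_def q_def
      by (rule cf_rem_prod_bounds(2)[of y t a]) (use y a in auto)
    have XY0: "0 \<le> X" "0 \<le> Y" unfolding X_def Y_def
      using cf_rem_bounds[of x] cf_rem_bounds[of y] x y(1,2) by (auto intro!: prod_nonneg)
    have XY: "X * Y \<le> 1 / q * (1 / q)" using X Y XY0 q by (intro mult_mono) auto
    have dx: "\<bar>x - y\<bar> = \<bar>\<theta> - \<theta>'\<bar> * (X * Y)"
      using common_prefix_dist[of x y t] x y nzx by (simp add: a_def \<theta>_def X_def Y_def)
    also have "\<dots> \<le> 1 * (X * Y)"
      using cf_rem_0_1[OF x, of t] th' XY0 by (intro mult_right_mono) (auto simp: \<theta>_def)
    finally have dxy: "\<bar>x - y\<bar> \<le> 1 / q * (1 / q)" using XY by simp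
    have "1 / q * (1 / q) \<le> 1 / q * 1" using q by (intro mult_left_mono) auto
    also have "1 / q < \<delta>" using t q \<delta>(1) by (simp add: q_def field_simps)
    finally have near: "\<bar>y - x\<bar> < \<delta>" using dxy by (simp add: abs_minus_commute)
    have dq: "\<bar>minkowski_qm x - minkowski_qm y\<bar> = \<bar>minkowski_qm \<theta> - minkowski_qm \<theta>'\<bar> / 2 ^ cf_sum x t"
      using common_prefix_qm_dist[of x y t] x y nzx by (simp add: a_def \<theta>_def)
    have "1 / 8 / 2 ^ cf_sum x t \<le> \<bar>minkowski_qm x - minkowski_qm y\<bar>"
      unfolding dq using th' by (intro divide_right_mono) auto
    moreover from this have "y \<noteq> x" by (auto simp: field_simps)
    then have "\<bar>minkowski_qm x - minkowski_qm y\<bar> \<le> \<bar>x - y\<bar>"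
      using \<delta>(2)[OF _ near] by (simp add: abs_divide field_simps abs_minus_commute)
    ultimately have "1 / 8 / 2 ^ cf_sum x t \<le> 1 / q * (1 / q)" using dxy by linarith
    then show "(cf_den a t)\<^sup>2 \<le> 8 * 2 ^ cf_sum x t"
      using q unfolding q_def[symmetric] by (simp add: field_simps power2_eq_square)
  qed
qed

text \<open>
  At an irrational point the Gauss map is continuous and the quotients are locally constant.
\<close>

lemma eventually_same_prefix:
  assumes x: "0 < x" "x < 1" "x \<notin> \<rat>"
  shows "\<forall>\<^sub>F y in at x. 0 < y \<and> y < 1 \<and> (\<forall>k<t. cf_rem y k \<noteq> 0 \<and> cf_quot y (Suc k) = cf_quot x (Suc k))"
proof -
  have lim: "((\<lambda>y. cf_rem y n) \<longlongrightarrow> cf_rem x n) (at x)" for n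
  proof (induction n)
    case (Suc n)
    have "((\<lambda>y. 1 / cf_rem y n) \<longlongrightarrow> 1 / cf_rem x n) (at x)"
      using Suc cf_rem_0_1[OF x, of n] by (intro tendsto_intros) auto
    moreover have "1 / cf_rem x n \<notin> \<int>"
      using cf_rem_irrational[OF x(3), of n] Ints_subset_Rats Rats_inverse[of "1 / cf_rem x n"] by auto
    ultimately show ?case by (auto simp: frac_def intro!: tendsto_diff tendsto_of_int_floor)
  qed simp
  have 1: "\<forall>\<^sub>F y in at x. cf_rem y k \<noteq> 0" for k
    using tendsto_imp_eventually_ne[OF lim] cf_rem_0_1[OF x, of k] by simp
  have 2: "\<forall>\<^sub>F y in at x. cf_quot y (Suc k) = cf_quot x (Suc k)" for k
  proof -
    have "((\<lambda>y. 1 / cf_rem y k) \<longlongrightarrow> 1 / cf_rem x k) (at x)"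
      using lim[of k] cf_rem_0_1[OF x, of k] by (intro tendsto_intros) auto
    moreover have "1 / cf_rem x k \<notin> \<int>"
      using cf_rem_irrational[OF x(3), of k] Ints_subset_Rats Rats_inverse[of "1 / cf_rem x k"] by auto
    ultimately have "\<forall>\<^sub>F y in at x. \<lfloor>1 / cf_rem y k\<rfloor> = \<lfloor>1 / cf_rem x k\<rfloor>"
      by (rule eventually_floor_eq)
    then show ?thesis by (rule eventually_mono) (simp add: cf_quot_def)
  qed
  have "\<forall>\<^sub>F y in at x. \<forall>k\<in>{..<t}. cf_rem y k \<noteq> 0 \<and> cf_quot y (Suc k) = cf_quot x (Suc k)"
    using 1 2 by (intro eventually_ball_finite) (auto intro: eventually_conj)
  moreover have "\<forall>\<^sub>F y in at x. y \<in> {0<..<1}" using x by (intro eventually_at_in_open') auto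
  ultimately show ?thesis by eventually_elim auto
qed

text \<open>
  If the expansions of \<open>x\<close> and \<open>y\<close> part after exactly \<open>t\<close> quotients, their remainders have
  different first quotients and so a bounded difference quotient. Pulling this back along the
  common prefix bounds the difference quotient of \<open>x\<close> and \<open>y\<close> by \<open>24 q\<^sub>t\<^sup>2 / 2 ^ S\<^sub>t\<close>.
\<close>

lemma den_bound_imp_deriv_0:
  assumes x: "0 < x" "x < 1" "x \<notin> \<rat>"
  defines "a \<equiv> \<lambda>k. cf_quot x (Suc k)"
  assumes lim: "(\<lambda>t. (cf_den a t)\<^sup>2 / 2 ^ cf_sum x t) \<longlonglongrightarrow> 0"
  shows "(minkowski_qm has_real_derivative 0) (at x)"
proof -
  have a: "a k \<ge> 1" for k using cf_rem_0_1[OF x] by (simp add: a_def)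
  have nzx: "cf_rem x k \<noteq> 0" for k using cf_rem_0_1[OF x, of k] by simp
  have "((\<lambda>y. (minkowski_qm y - minkowski_qm x) / (y - x)) \<longlongrightarrow> 0) (at x)"
  proof (rule tendstoI)
    fix e :: real assume e: "e > 0"
    have "\<forall>\<^sub>F t in sequentially. (cf_den a t)\<^sup>2 / 2 ^ cf_sum x t < e / 24"
      using order_tendstoD(2)[OF lim, of "e / 24"] e by simp
    then obtain T where T: "\<And>t. t \<ge> T \<Longrightarrow> (cf_den a t)\<^sup>2 / 2 ^ cf_sum x t < e / 24"
      by (auto simp: eventually_sequentially)
    have "\<forall>\<^sub>F y in at x. y \<noteq> x" by (simp add: eventually_at_filter)
    with eventually_same_prefix[OF x, of T]
    show "\<forall>\<^sub>F y in at x. dist ((minkowski_qm y - minkowski_qm x) / (y - x)) 0 < e"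
    proof eventually_elim
      case (elim y)
      define good where "good k \<longleftrightarrow> cf_rem y k \<noteq> 0 \<and> cf_quot y (Suc k) = a k" for k
      define agree where "agree t \<longleftrightarrow> (\<forall>k<t. good k)" for t
      have bd: "\<bar>x - y\<bar> = \<bar>cf_rem x t - cf_rem y t\<bar> * ((\<Prod>k<t. cf_rem x k) * (\<Prod>k<t. cf_rem y k))"
        "\<bar>minkowski_qm x - minkowski_qm y\<bar>
          = \<bar>minkowski_qm (cf_rem x t) - minkowski_qm (cf_rem y t)\<bar> / 2 ^ cf_sum x t"
        if "agree t" for t
        using common_prefix_dist[of x y t] common_prefix_qm_dist[of x y t] that x elim nzx
        by (auto simp: agree_def good_def a_def)
      have pb: "1 / (2 * cf_den a t) \<le> (\<Prod>k<t. cf_rem x k)" 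
        "1 / (2 * cf_den a t) \<le> (\<Prod>k<t. cf_rem y k)" if "agree t" for t
        using cf_rem_prod_bounds(1)[of x t a, OF _ _ _ a] cf_rem_prod_bounds(1)[of y t a, OF _ _ _ a] that x elim nzx
        by (auto simp: agree_def good_def a_def)
      have ex: "\<exists>k. \<not> good k"
      proof (rule ccontr)
        assume "\<not> ?thesis"
        then have p: "agree t" for t by (simp add: agree_def)
        obtain t where t: "1 / \<bar>x - y\<bar> < cf_den a t"
          using eventually_happens[OF cf_den_at_top[of a, OF a, unfolded filterlim_at_top_dense, rule_format]]
          by auto
        have "(\<Prod>k<t. cf_rem x k) \<le> 1 / cf_den a t"
          using x nzx a by (intro cf_rem_prod_bounds) (auto simp: a_def)
        moreover have "(\<Prod>k<t. cf_rem y k) \<le> 1" "0 \<le> (\<Prod>k<t. cf_rem y k)" "0 \<le> (\<Prod>k<t. cf_rem x k)"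
          using cf_rem_bounds[of y] cf_rem_bounds[of x] x elim by (auto intro!: prod_le_1 prod_nonneg)
        moreover have "\<bar>cf_rem x t - cf_rem y t\<bar> \<le> 1"
          using cf_rem_bounds[of y t] cf_rem_bounds[of x t] x elim by auto
        ultimately have "\<bar>x - y\<bar> \<le> 1 * (1 / cf_den a t * 1)"
          unfolding bd(1)[OF p[of t]] using cf_den_ge_1[of a t, OF a] by (intro mult_mono) auto
        moreover have "0 < \<bar>x - y\<bar>" using elim by auto
        ultimately show False using t cf_den_ge_1[of a t, OF a] by (simp add: field_simps)
      qed
      \<comment> \<open>The first place where the expansions of \<open>x\<close> and \<open>y\<close> part; it is late because \<open>y\<close> is near \<open>x\<close>.\<close>
      define t where "t = (LEAST k. \<not> good k)"
      have ng: "\<not> good t" unfolding t_def by (rule LeastI_ex[OF ex])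
      have pt: "agree t" unfolding agree_def t_def using not_less_Least by blast
      have "T \<le> t" 
      proof (rule ccontr)
        assume "\<not> T \<le> t"
        then have "good t" using elim by (simp add: good_def a_def)
        then show False using ng by simp
      qed
      define q where "q = cf_den a t"
      have q: "1 \<le> q" unfolding q_def by (rule cf_den_ge_1[OF a])
      define r s where "r = cf_rem x t" and "s = cf_rem y t"
      have "\<bar>minkowski_qm r - minkowski_qm s\<bar> \<le> 6 * \<bar>r - s\<bar>"
      proof (rule qm_lipschitz_distinct_quot)
        show "0 < r" "r \<le> 1" using cf_rem_0_1[OF x, of t] by (auto simp: r_def)
        show "0 \<le> s" "s \<le> 1" using cf_rem_bounds[of y t] elim by (auto simp: s_def)
        show "s = 0 \<or> cf_quot r 1 \<noteq> cf_quot s 1"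
          using ng by (auto simp: good_def a_def r_def s_def cf_quot_def)
      qed
      also have "\<bar>r - s\<bar> \<le> 4 * q\<^sup>2 * \<bar>x - y\<bar>"
      proof -
        have "1 / (2 * q) * (1 / (2 * q)) \<le> (\<Prod>k<t. cf_rem x k) * (\<Prod>k<t. cf_rem y k)"
          using pb[OF pt] q by (intro mult_mono order_trans[OF _ pb(1)[OF pt]]) (auto simp: q_def)
        then have "\<bar>r - s\<bar> * (1 / (2 * q) * (1 / (2 * q))) \<le> \<bar>x - y\<bar>"
          unfolding bd(1)[OF pt] r_def s_def by (intro mult_left_mono) auto
        then show ?thesis using q by (simp add: field_simps power2_eq_square)
      qed
      finally have "\<bar>minkowski_qm r - minkowski_qm s\<bar> \<le> 24 * q\<^sup>2 * \<bar>x - y\<bar>" by simp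
      then have "\<bar>minkowski_qm x - minkowski_qm y\<bar> \<le> 24 * q\<^sup>2 * \<bar>x - y\<bar> / 2 ^ cf_sum x t"
        unfolding bd(2)[OF pt] r_def s_def by (intro divide_right_mono) auto
      also have "\<dots> = 24 * (q\<^sup>2 / 2 ^ cf_sum x t) * \<bar>x - y\<bar>" by simp
      also have "\<dots> < e * \<bar>x - y\<bar>"
      proof (rule mult_strict_right_mono)
        show "24 * (q\<^sup>2 / 2 ^ cf_sum x t) < e" using T[OF \<open>T \<le> t\<close>] unfolding q_def by linarith
      qed (use elim in auto)
      finally show ?case using elim by (simp add: dist_real_def abs_divide field_simps abs_minus_commute)
    qed
  qed
  then show ?thesis by (simp add: has_field_derivative_iff)
qed

section \<open>The lower bound for the maximal drift\<close>

lemma kappa1_ln: "kappa1 * ln 2 = 2 * ln golden"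
  by (simp add: kappa1_def)

lemma kappa1_gt_1: "1 < kappa1"
proof -
  have "ln 2 < ln (golden * golden)" using golden_bounds by (intro ln_less_cancel_iff[THEN iffD2]) auto
  also have "\<dots> = 2 * ln golden" using golden_gt_1 by (simp add: ln_mult)
  finally show ?thesis by (simp add: kappa1_def)
qed

lemma kappa1_le_2: "kappa1 \<le> 2"
proof -
  have "ln golden \<le> ln 2" using golden_bounds by (intro ln_le_cancel_iff[THEN iffD2]) auto
  then show ?thesis by (simp add: kappa1_def pos_divide_le_eq)
qed

lemma kappa4_sq: "kappa4\<^sup>2 * ln 2 = kappa1 - 1" and kappa4_pos: "0 < kappa4"
  using kappa1_gt_1 by (auto simp: kappa4_def)

lemma phi1_eq: "phi1 x t = (\<Sum>k<t. real (cf_quot x (Suc k)) - kappa1)"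
  by (simp add: phi1_def cf_sum_eq sum_subtractf)

text \<open>
  Logarithms of the lower bound for \<open>q\<^sub>t\<close>: the part \<open>\<Phi>\<^sup>t\<close> is absorbed by \<open>kappa1\<close>, and every quotient
  greater than 1 forces the drift \<open>S\<^sub>t - kappa1 t\<close> up.
\<close>

lemma den_bound_drift:
  assumes a: "\<And>k. a k \<ge> 1" and C: "C > 0"
    and den: "(cf_den a t)\<^sup>2 \<le> C * 2 ^ (\<Sum>k<t. a k)"
  shows "2 / ln 2 * (\<Sum>k<t. ln ((real (a k) + 2) / 3)) - (ln C + 2 * ln golden) / ln 2
    \<le> (\<Sum>k<t. real (a k) - kappa1)"
proof -
  define P where "P = (\<Prod>k<t. (real (a k) + 2) / 3)"
  have P: "0 < P" unfolding P_def by (intro prod_pos) auto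
  have lnP: "ln P = (\<Sum>k<t. ln ((real (a k) + 2) / 3))"
    unfolding P_def by (intro ln_prod) auto
  have q: "0 < cf_den a t" using cf_den_ge_1[of a t, OF a] by simp
  have "(golden ^ t * P)\<^sup>2 \<le> (golden * cf_den a t)\<^sup>2"
    using cf_den_lower[of a t, OF a] P golden_gt_1 unfolding P_def[symmetric] by (intro power_mono) auto
  also have "\<dots> \<le> golden\<^sup>2 * (C * 2 ^ (\<Sum>k<t. a k))"
    unfolding power_mult_distrib using den by (intro mult_left_mono) auto
  finally have "ln ((golden ^ t * P)\<^sup>2) \<le> ln (golden\<^sup>2 * (C * 2 ^ (\<Sum>k<t. a k)))"
    using P C golden_gt_1 by (intro ln_le_cancel_iff[THEN iffD2]) auto
  then have "2 * (real t * ln golden + ln P) \<le> 2 * ln golden + (ln C + real (\<Sum>k<t. a k) * ln 2)"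
    using P C golden_gt_1 by (simp add: ln_mult ln_realpow del: of_nat_sum)
  then have "2 * ln P - (ln C + 2 * ln golden) \<le> (real (\<Sum>k<t. a k) - kappa1 * real t) * ln 2"
  proof -
    have "kappa1 * real t * ln 2 = real t * (2 * ln golden)"
      unfolding kappa1_ln[symmetric] by (simp only: ac_simps)
    moreover have "2 * (real t * ln golden + ln P) = real t * (2 * ln golden) + 2 * ln P"
      by (simp add: algebra_simps)
    ultimately show ?thesis using \<open>2 * (real t * ln golden + ln P) \<le> _\<close>
      unfolding left_diff_distrib by linarith
  qed
  then have "(2 * ln P - (ln C + 2 * ln golden)) / ln 2 \<le> real (\<Sum>k<t. a k) - kappa1 * real t"
    by (simp add: pos_divide_le_eq del: of_nat_sum)
  then show ?thesis by (simp add: lnP[symmetric] diff_divide_distrib sum_subtractf mult.commute)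
qed

text \<open>
  The third bound, from \<open>ln g \<ge> 1 - 1 / g\<close>, lets the logarithm pay for small quotients.
\<close>

lemma ln_quot_bounds:
  fixes a :: nat assumes a: "a \<ge> 1"
  shows "0 \<le> ln ((real a + 2) / 3)" "ln ((real a + 2) / 3) \<le> ln (real a)"
    "real a - 1 \<le> (real a + 2) * ln ((real a + 2) / 3)"
proof -
  define g where "g = (real a + 2) / 3"
  have g: "1 \<le> g" "g \<le> real a" "real a = 3 * g - 2" using a by (auto simp: g_def field_simps)
  show "0 \<le> ln ((real a + 2) / 3)" using g by (simp add: g_def[symmetric])
  show "ln ((real a + 2) / 3) \<le> ln (real a)" using g by (simp add: g_def[symmetric])
  have "1 - 1 / g \<le> ln g" using ln_le_minus_one[of "1 / g"] g by (simp add: ln_div)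
  then have "3 * g * (1 - 1 / g) \<le> 3 * g * ln g" using g by (intro mult_left_mono) auto
  then show "real a - 1 \<le> (real a + 2) * ln ((real a + 2) / 3)"
    using g unfolding g_def[symmetric] by (simp add: algebra_simps)
qed

text \<open>
  Let \<open>G\<close> be the floor that the drift \<open>\<phi>\<close> may not fall below, and \<open>N\<close> its ceiling. The floor rises by
  a multiple of \<open>ln a\<^sub>u\<close> with every quotient, and \<open>a\<^sub>u\<close> is at most the room left, about \<open>N - G u\<close>.
  Sustaining the drift needs \<open>\<Sum> (a\<^sub>u - 1) \<ge> (kappa1 - 1) t\<close> up to a constant, but a rise \<open>d\<close> of the
  floor buys at most about \<open>(N - G) d / ln N\<close> (times \<open>ln 2 / 2\<close>), in total
  \<open>N\<^sup>2 / (2 ln N)\<close>. Hence \<open>t\<close> is bounded. The threshold \<open>L\<close> separates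
  quotients whose logarithm is comparable to \<open>ln N\<close> from smaller ones, whose contribution is
  negligible.
\<close>

lemma bounded_drift_time_bound:
  fixes a :: "nat \<Rightarrow> nat" and N K L :: real
  defines "\<phi> \<equiv> \<lambda>u. \<Sum>k<u. real (a k) - kappa1"
    and "G \<equiv> \<lambda>u. 2 / ln 2 * (\<Sum>k<u. ln ((real (a k) + 2) / 3))"
    and "H \<equiv> N + K + kappa1"
  assumes a: "\<And>k. a k \<ge> 1" and K: "0 \<le> K" and L: "3 < L" and t: "t \<ge> 1"
    and low: "\<And>u. u \<le> t \<Longrightarrow> G u - K \<le> \<phi> u"
    and up: "\<And>u. 1 \<le> u \<Longrightarrow> u \<le> t \<Longrightarrow> \<phi> u \<le> N"
  shows "(kappa1 - 1) * real t
    \<le> K + ln 2 / 2 * ((L + 2) * H + (H\<^sup>2 + 2 / ln 2 * ln H * H) / (2 * ln (L / 3)))"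
proof -
  define d where "d k = 2 / ln 2 * ln ((real (a k) + 2) / 3)" for k
  define \<delta> where "\<delta> = 2 / ln 2 * ln H"
  define l where "l = ln (L / 3)"
  have l: "0 < l" using L by (simp add: l_def)
  have GS: "G (Suc u) = G u + d u" for u by (simp add: G_def d_def algebra_simps add_divide_distrib)
  have d0: "0 \<le> d u" for u using ln_quot_bounds(1)[OF a] by (simp add: d_def)
  have G0: "0 \<le> G u" for u by (induction u) (use d0 GS in \<open>auto simp: G_def\<close>)
  have Gt: "G t \<le> N + K" using low[of t] up[of t] t by simp
  have mono: "G u \<le> G v" if "u \<le> v" for u v
    by (rule lift_Suc_mono_le[of G, OF _ that]) (use GS d0 in auto)
  have ak: "real (a u) \<le> H - G u" if "u < t" for u
    using up[of "Suc u"] low[of u] that by (simp add: H_def \<phi>_def)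
  have H: "1 \<le> H" using ak[of 0] t G0[of 0] a[of 0] by simp
  have GH: "G u \<le> H" if "u \<le> t" for u
    using mono[OF that] Gt kappa1_gt_1 by (simp add: H_def)
  have d\<delta>: "d u \<le> \<delta>" if "u < t" for u
  proof -
    have "ln ((real (a u) + 2) / 3) \<le> ln (real (a u))" by (rule ln_quot_bounds(2)[OF a])
    also have "\<dots> \<le> ln H" using ak[OF that] a[of u] G0[of u] by simp
    finally show ?thesis by (simp add: d_def \<delta>_def divide_right_mono)
  qed
  \<comment> \<open>A quotient \<open>a\<^sub>u \<le> L\<close> is paid for by the first summand; for \<open>a\<^sub>u > L\<close> the logarithm is at least
    \<open>l\<close> while \<open>a\<^sub>u\<close> fits into the room \<open>H - G u\<close>.\<close>
  have step: "real (a u) - 1 \<le> ln 2 / 2 * (((L + 2) + (H - G u) / l) * d u)" if "u < t" for u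
  proof -
    define w where "w = ln ((real (a u) + 2) / 3)"
    have w: "0 \<le> w" unfolding w_def by (rule ln_quot_bounds(1)[OF a])
    have HG: "0 \<le> (H - G u) / l" using GH[of u] that l by simp
    have "real (a u) - 1 \<le> ((L + 2) + (H - G u) / l) * w"
    proof (cases "real (a u) \<le> L")
      case True
      have "real (a u) - 1 \<le> (real (a u) + 2) * w" unfolding w_def by (rule ln_quot_bounds(3)[OF a])
      also have "\<dots> \<le> ((L + 2) + (H - G u) / l) * w"
        using True HG w by (intro mult_right_mono) auto
      finally show ?thesis .
    next
      case False
      have "L / 3 \<le> (real (a u) + 2) / 3" using False by simp
      then have "l \<le> w" unfolding l_def w_def using L a by (intro ln_le_cancel_iff[THEN iffD2]) auto
      then have "1 * (H - G u) \<le> (w / l) * (H - G u)"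
        using l GH[of u] that by (intro mult_right_mono) (auto simp: le_divide_eq)
      then have "H - G u \<le> (w / l) * (H - G u)" by (simp only: mult_1)
      moreover have "0 \<le> (L + 2) * w" using L w by simp
      moreover have "(w / l) * (H - G u) = (H - G u) / l * w" by simp
      ultimately show ?thesis using ak[OF that] unfolding distrib_right by linarith
    qed
    also have "w = ln 2 / 2 * d u" by (simp add: w_def d_def)
    finally show ?thesis by (simp add: mult.left_commute)
  qed
  \<comment> \<open>The sum of \<open>(H - G u) d\<^sub>u\<close> is a left Riemann sum of \<open>\<integral> (H - s) ds\<close>: it exceeds
    the telescoping difference of \<open>(H - G u)\<^sup>2 / 2\<close> by at most half of \<open>\<Sum> d\<^sub>u\<^sup>2 \<le> \<delta> G t\<close>.\<close>
  have sum_le: "(\<Sum>k<u. real (a k) - 1)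
      \<le> ln 2 / 2 * ((L + 2) * G u + (H\<^sup>2 - (H - G u)\<^sup>2 + \<delta> * G u) / (2 * l))" if "u \<le> t" for u
    using that
  proof (induction u)
    case 0
    then show ?case by (simp add: G_def)
  next
    case (Suc u)
    have "d u * d u \<le> \<delta> * d u" using d\<delta>[of u] d0[of u] Suc.prems by (intro mult_right_mono) auto
    then have "(2 * (H - G u)) * d u \<le> (H - G u)\<^sup>2 - (H - G u - d u)\<^sup>2 + \<delta> * d u"
      by (simp add: power2_eq_square algebra_simps)
    then have "(2 * (H - G u)) * d u / (2 * l) \<le> ((H - G u)\<^sup>2 - (H - G u - d u)\<^sup>2 + \<delta> * d u) / (2 * l)"
      using l by (intro divide_right_mono) auto
    then have "((L + 2) + (H - G u) / l) * d u
        \<le> (L + 2) * d u + ((H - G u)\<^sup>2 - (H - G u - d u)\<^sup>2 + \<delta> * d u) / (2 * l)"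
    proof -
      have "2 * (H - G u) * d u / (2 * l) = (H - G u) / l * d u"
        using l by (simp only: mult.assoc times_divide_eq_left mult_divide_mult_cancel_left zero_neq_numeral not_False_eq_True)
      then show ?thesis
        using \<open>2 * (H - G u) * d u / (2 * l) \<le> _\<close> unfolding distrib_right by linarith
    qed
    then have "ln 2 / 2 * (((L + 2) + (H - G u) / l) * d u)
        \<le> ln 2 / 2 * ((L + 2) * d u + ((H - G u)\<^sup>2 - (H - G u - d u)\<^sup>2 + \<delta> * d u) / (2 * l))"
      by (intro mult_left_mono) auto
    moreover have e: "(L + 2) * G (Suc u) + (H\<^sup>2 - (H - G (Suc u))\<^sup>2 + \<delta> * G (Suc u)) / (2 * l)
      = ((L + 2) * G u + (H\<^sup>2 - (H - G u)\<^sup>2 + \<delta> * G u) / (2 * l))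
        + ((L + 2) * d u + ((H - G u)\<^sup>2 - (H - G u - d u)\<^sup>2 + \<delta> * d u) / (2 * l))"
      by (simp add: GS algebra_simps add_divide_distrib diff_divide_distrib)
    moreover have "(\<Sum>k<u. real (a k) - 1)
        \<le> ln 2 / 2 * ((L + 2) * G u + (H\<^sup>2 - (H - G u)\<^sup>2 + \<delta> * G u) / (2 * l))"
      using Suc by simp
    moreover have "real (a u) - 1 \<le> ln 2 / 2 * (((L + 2) + (H - G u) / l) * d u)"
      using step[of u] Suc.prems by simp
    ultimately show ?case unfolding sum.lessThan_Suc e
      by (subst distrib_left) linarith
  qed
  have "(kappa1 - 1) * real t - K \<le> (\<Sum>k<t. real (a k) - 1)"
    using low[of t] G0[of t] by (simp add: \<phi>_def sum_subtractf algebra_simps)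
  also have "\<dots> \<le> ln 2 / 2 * ((L + 2) * G t + (H\<^sup>2 - (H - G t)\<^sup>2 + \<delta> * G t) / (2 * l))"
    by (rule sum_le) simp
  also have "\<dots> \<le> ln 2 / 2 * ((L + 2) * H + (H\<^sup>2 + \<delta> * H) / (2 * l))"
  proof -
    have "0 \<le> \<delta>" using H by (simp add: \<delta>_def)
    then have "\<delta> * G t \<le> \<delta> * H" using GH[of t] by (intro mult_left_mono) auto
    then have "(H\<^sup>2 - (H - G t)\<^sup>2 + \<delta> * G t) / (2 * l) \<le> (H\<^sup>2 + \<delta> * H) / (2 * l)"
      using l zero_le_power2[of "H - G t"] by (intro divide_right_mono) linarith+
    moreover have "(L + 2) * G t \<le> (L + 2) * H" using GH[of t] L by (intro mult_left_mono) auto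
    ultimately have "(L + 2) * G t + (H\<^sup>2 - (H - G t)\<^sup>2 + \<delta> * G t) / (2 * l)
        \<le> (L + 2) * H + (H\<^sup>2 + \<delta> * H) / (2 * l)" by linarith
    then show ?thesis by (rule mult_left_mono) simp
  qed
  finally show ?thesis unfolding \<delta>_def l_def by linarith
qed

text \<open>
  With \<open>N = c (t ln t)\<^sup>1\<^sup>/\<^sup>2\<close> one has \<open>ln N \<sim> (ln t) / 2\<close>, so the time bound is asymptotic to \<open>c\<^sup>2 t ln 2 / 2\<close>;
  this is where \<open>c\<^sup>2 < 2 kappa4\<^sup>2\<close> is decisive. The choice \<open>L = N / (ln t)\<^sup>2\<close> satisfies both
  \<open>ln L \<sim> ln N\<close> and \<open>L = o(N / ln N)\<close>.
\<close>

lemma time_bound_asymptotics: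
  fixes c K :: real
  assumes c: "0 < c" "c\<^sup>2 < 2 * kappa4\<^sup>2" and K: "0 \<le> K"
  defines "H \<equiv> \<lambda>t::nat. c * sqrt (real t * ln (real t)) + K + kappa1"
    and "L \<equiv> \<lambda>t::nat. c * sqrt (real t * ln (real t)) / (ln (real t))\<^sup>2"
  shows "\<forall>\<^sub>F t in sequentially. 3 < L t \<and>
    K + ln 2 / 2 * ((L t + 2) * H t + ((H t)\<^sup>2 + 2 / ln 2 * ln (H t) * H t) / (2 * ln (L t / 3)))
      < (kappa1 - 1) * real t"
proof -
  have k1: "kappa1 > 0" using kappa1_gt_1 by simp
  have lim: "(\<lambda>t. (K + ln 2 / 2 * ((L t + 2) * H t + ((H t)\<^sup>2 + 2 / ln 2 * ln (H t) * H t) / (2 * ln (L t / 3)))) / real t)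
     \<longlonglongrightarrow> c\<^sup>2 * ln 2 / 2"
    unfolding L_def H_def using c(1) k1 by real_asymp
  have "c\<^sup>2 * ln 2 < 2 * kappa4\<^sup>2 * ln 2" using c(2) by (intro mult_strict_right_mono) auto
  then have "c\<^sup>2 * ln 2 / 2 < kappa1 - 1" using kappa4_sq by linarith
  from order_tendstoD(2)[OF lim this] 
  have "\<forall>\<^sub>F t in sequentially. (K + ln 2 / 2 * ((L t + 2) * H t + ((H t)\<^sup>2 + 2 / ln 2 * ln (H t) * H t) / (2 * ln (L t / 3)))) / real t < kappa1 - 1" .
  moreover have "\<forall>\<^sub>F t in sequentially. 3 < L t" unfolding L_def using c(1) by real_asymp
  moreover have "\<forall>\<^sub>F t in sequentially. 0 < t" by (rule eventually_gt_at_top)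
  ultimately show ?thesis
    by eventually_elim (simp add: pos_divide_less_eq)
qed

text \<open>
  If the drift stayed below \<open>c (t ln t)\<^sup>1\<^sup>/\<^sup>2\<close> up to time \<open>t\<close>, the time bound would contradict its own
  asymptotics.
\<close>

lemma max_phi1_lower:
  fixes x \<epsilon> :: real
  assumes x: "0 < x" "x < 1" "x \<notin> \<rat>" and d: "(minkowski_qm has_real_derivative 0) (at x)" and e: "\<epsilon> > 0"
  shows "\<forall>\<^sub>F t in sequentially. Max (phi1 x ` {1..t}) \<ge> (sqrt 2 - \<epsilon>) * kappa4 * sqrt (real t * ln (real t))"
proof -
  define a where "a = (\<lambda>k. cf_quot x (Suc k))"
  have a: "a k \<ge> 1" for k using cf_rem_0_1[OF x] by (simp add: a_def)
  \<comment> \<open>Shrinking \<open>\<epsilon>\<close> strengthens the claim and makes \<open>c\<close> positive.\<close>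
  define \<epsilon>' where "\<epsilon>' = min \<epsilon> 1"
  define c where "c = (sqrt 2 - \<epsilon>') * kappa4"
  have s2: "1 < sqrt (2::real)" by simp
  have e': "0 < \<epsilon>'" "\<epsilon>' \<le> 1" "\<epsilon>' \<le> \<epsilon>" using e by (auto simp: \<epsilon>'_def)
  have c0: "0 < c" unfolding c_def using e'(2) s2 kappa4_pos by (intro mult_pos_pos) linarith+
  have "c < sqrt 2 * kappa4" unfolding c_def using e' kappa4_pos by (intro mult_strict_right_mono) auto
  then have "c\<^sup>2 < (sqrt 2 * kappa4)\<^sup>2" using c0 by (intro power_strict_mono) auto
  then have c2: "c\<^sup>2 < 2 * kappa4\<^sup>2" by (simp add: power_mult_distrib)
  obtain T where T: "\<And>t. t \<ge> T \<Longrightarrow> (cf_den a t)\<^sup>2 \<le> 8 * 2 ^ cf_sum x t"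
    using deriv_0_imp_den_bound[OF x d] by (auto simp: eventually_sequentially a_def)
  define C where "C = 8 + (\<Sum>t<T. (cf_den a t)\<^sup>2)"
  have C: "C \<ge> 8" by (simp add: C_def sum_nonneg)
  have den: "(cf_den a t)\<^sup>2 \<le> C * 2 ^ (\<Sum>k<t. a k)" for t
  proof (cases "t < T")
    case True
    have "(cf_den a t)\<^sup>2 \<le> (\<Sum>t<T. (cf_den a t)\<^sup>2)" using True by (intro member_le_sum) auto
    also have "\<dots> \<le> C * 1" by (simp add: C_def)
    also have "\<dots> \<le> C * 2 ^ (\<Sum>k<t. a k)" using C by (intro mult_left_mono) auto
    finally show ?thesis .
  next
    case False
    then have "(cf_den a t)\<^sup>2 \<le> 8 * 2 ^ (\<Sum>k<t. a k)" using T[of t] by (simp add: cf_sum_eq a_def)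
    also have "\<dots> \<le> C * 2 ^ (\<Sum>k<t. a k)" using C by (intro mult_right_mono) auto
    finally show ?thesis .
  qed
  define K where "K = (ln C + 2 * ln golden) / ln 2"
  have K: "0 \<le> K" using C golden_gt_1 by (simp add: K_def)
  have "\<forall>\<^sub>F t::nat in sequentially. 1 \<le> t" by (rule eventually_ge_at_top)
  with time_bound_asymptotics[OF c0 c2 K] show ?thesis
  proof eventually_elim
    case (elim t)
    define N where "N = c * sqrt (real t * ln (real t))"
    have "\<exists>u\<in>{1..t}. N < phi1 x u"
    proof (rule ccontr)
      assume "\<not> ?thesis"
      then have up: "(\<Sum>k<u. real (a k) - kappa1) \<le> N" if "1 \<le> u" "u \<le> t" for u
        using that by (auto simp: phi1_eq a_def not_less)
      have low: "2 / ln 2 * (\<Sum>k<u. ln ((real (a k) + 2) / 3)) - K \<le> (\<Sum>k<u. real (a k) - kappa1)" for u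
        unfolding K_def using den_bound_drift[of a C u, OF a _ den] C by simp
      show False
        using bounded_drift_time_bound[of a K "N / (ln (real t))\<^sup>2" t N, OF a K _ _ low up] elim
        unfolding N_def by simp
    qed
    then obtain u where u: "u \<in> {1..t}" "N < phi1 x u" by blast
    have "(sqrt 2 - \<epsilon>) * kappa4 * sqrt (real t * ln (real t)) \<le> N"
      unfolding N_def c_def using e' kappa4_pos elim(2) by (intro mult_right_mono) auto
    also have "\<dots> \<le> phi1 x u" using u by simp
    also have "\<dots> \<le> Max (phi1 x ` {1..t})" using u by (intro Max_ge) auto
    finally show ?case .
  qed
qed

section \<open>Irrationals with prescribed partial quotients\<close>

text \<open>
  On fractions the Gauss map is the Euclidean algorithm, so the numerators decrease.
\<close>

lemma cf_rem_rat_terminates: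
  assumes "x \<in> \<rat>" "0 \<le> x" "x < 1"
  shows "\<exists>n. cf_rem x n = 0"
proof -
  have main: "\<exists>n. cf_rem (real p / real q) n = 0" if "p < q" for p q :: nat
    using that
  proof (induction p arbitrary: q rule: less_induct)
    case (less p)
    show ?case
    proof (cases "p = 0")
      case True
      then show ?thesis by (intro exI[of _ 0]) simp
    next
      case False
      have "real q = real (q div p) * real p + real (q mod p)"
        by (metis div_mult_mod_eq of_nat_add of_nat_mult)
      then have "real q / real p = of_int (int (q div p)) + real (q mod p) / real p"
        using False by (simp add: field_simps)
      moreover have "real (q mod p) / real p < 1" using False by simp
      ultimately have "frac (real q / real p) = real (q mod p) / real p"
        by (simp add: frac_unique_iff)
      moreover obtain n where "cf_rem (real (q mod p) / real p) n = 0"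
        using less.IH[of "q mod p" p] False by auto
      ultimately have "cf_rem (real p / real q) (Suc n) = 0" by (simp add: cf_rem_Suc_frac del: cf_rem.simps)
      then show ?thesis by blast
    qed
  qed
  obtain m n :: nat where "n \<noteq> 0" "\<bar>x\<bar> = real m / real n"
    using assms(1) by (rule Rats_abs_nat_div_natE)
  then have x: "x = real m / real n" using assms by simp
  then have "m < n" using assms(3) \<open>n \<noteq> 0\<close> by simp
  with x show ?thesis using main by auto
qed

text \<open>
  The closed cylinder of points with first quotients \<open>a 0, \<dots>, a (n - 1)\<close>; both endpoints are included,
  which makes it compact.
\<close>

primrec cf_cyl :: "(nat \<Rightarrow> nat) \<Rightarrow> nat \<Rightarrow> real set" where
  "cf_cyl a 0 = {0..1}"
| "cf_cyl a (Suc n) = (\<lambda>y. 1 / (real (a 0) + y)) ` cf_cyl (\<lambda>k. a (Suc k)) n"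

lemma cf_cyl_subset:
  assumes "\<And>k. a k \<ge> 1"
  shows "cf_cyl a n \<subseteq> {0..1}"
  using assms
proof (induction n arbitrary: a)
  case (Suc n)
  have "1 / (real (a 0) + y) \<in> {0..1}" if "y \<in> cf_cyl (\<lambda>k. a (Suc k)) n" for y
  proof -
    have "y \<in> {0..1}" using Suc.IH[of "\<lambda>k. a (Suc k)"] Suc.prems that by blast
    then show ?thesis using Suc.prems[of 0] by simp
  qed
  then show ?case by auto
qed simp

text \<open>
  The cylinders are nested because \<open>1 / (a + y)\<close> stays in the unit interval.
\<close>

lemma cf_cyl_decseq:
  assumes "\<And>k. a k \<ge> 1"
  shows "cf_cyl a (Suc n) \<subseteq> cf_cyl a n"
  using assms
proof (induction n arbitrary: a)
  case 0
  then show ?case using cf_cyl_subset[of a 1] by simp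
next
  case (Suc n)
  show ?case unfolding cf_cyl.simps(2)[of a "Suc n"] cf_cyl.simps(2)[of a n]
    by (intro image_mono Suc.IH Suc.prems)
qed

lemma cf_cyl_compact:
  assumes "\<And>k. a k \<ge> 1"
  shows "compact (cf_cyl a n)"
  using assms
proof (induction n arbitrary: a)
  case (Suc n)
  have "continuous_on (cf_cyl (\<lambda>k. a (Suc k)) n) (\<lambda>y. 1 / (real (a 0) + y))"
  proof (intro continuous_intros ballI)
    fix y assume "y \<in> cf_cyl (\<lambda>k. a (Suc k)) n"
    then have "0 \<le> y" using cf_cyl_subset[of "\<lambda>k. a (Suc k)" n] Suc.prems by auto
    then show "real (a 0) + y \<noteq> 0" using Suc.prems[of 0] by simp
  qed
  then show ?case using Suc.IH[of "\<lambda>k. a (Suc k)"] Suc.prems by (auto intro: compact_continuous_image)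
qed simp

lemma cf_cyl_nonempty: "cf_cyl a n \<noteq> {}"
  by (induction n arbitrary: a) auto

text \<open>
  A point in the intersection of the nested compact cylinders has the prescribed expansion. Its
  remainders are themselves such points, hence positive, so the expansion does not terminate and
  the point is irrational.
\<close>

lemma ex_irrational_cf:
  assumes a: "\<And>k. a k \<ge> 1"
  shows "\<exists>x. 0 < x \<and> x < 1 \<and> x \<notin> \<rat> \<and> (\<forall>k. cf_quot x (Suc k) = a k)"
proof -
  \<comment> \<open>\<open>P\<close> is inherited by tails, so that it carries the whole expansion.\<close>
  define P where "P a x \<longleftrightarrow> (\<forall>k. (1::nat) \<le> a k) \<and> (\<forall>n. x \<in> cf_cyl a n)" for a x
  have unfold: "\<exists>y. x = 1 / (real (b 0) + y) \<and> P (\<lambda>k. b (Suc k)) y" if "P b x" for b x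
  proof -
    define y where "y = 1 / x - real (b 0)"
    have "x = 1 / (real (b 0) + y) \<and> y \<in> cf_cyl (\<lambda>k. b (Suc k)) n" for n
    proof -
      have "x \<in> cf_cyl b (Suc n)" using that unfolding P_def by blast
      then obtain z where "z \<in> cf_cyl (\<lambda>k. b (Suc k)) n" "x = 1 / (real (b 0) + z)" by auto
      then show ?thesis by (simp add: y_def)
    qed
    then show ?thesis using that unfolding P_def by blast
  qed
  have pos: "0 < x \<and> x < 1" if P: "P b x" for b x
  proof -
    have pos: "0 < x" if P: "P b x" for b x
    proof -
      obtain y where y: "x = 1 / (real (b 0) + y)" "P (\<lambda>k. b (Suc k)) y" using unfold[OF P] by blast
      have "y \<in> cf_cyl (\<lambda>k. b (Suc k)) 0" using y(2) unfolding P_def by blast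
      then have "0 \<le> y" by simp
      moreover have "1 \<le> b 0" using P unfolding P_def by blast
      ultimately show ?thesis unfolding y(1) by simp
    qed
    obtain y where y: "x = 1 / (real (b 0) + y)" "P (\<lambda>k. b (Suc k)) y" using unfold[OF P] by blast
    have "0 < y" using pos[OF y(2)] .
    moreover have "1 \<le> b 0" using P unfolding P_def by blast
    ultimately have "x < 1" unfolding y(1) by simp
    then show ?thesis using pos[OF P] by blast
  qed
  have cf: "P (\<lambda>k. b (n + k)) (cf_rem x n)" if P: "P b x" for b x n
  proof (induction n)
    case 0
    then show ?case using P by simp
  next
    case (Suc n)
    obtain y where y: "cf_rem x n = 1 / (real (b n) + y)" "P (\<lambda>k. b (n + Suc k)) y"
      using unfold[OF Suc] by auto
    have "frac (1 / cf_rem x n) = y" unfolding y(1)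
      using recip_cf(4)[of "b n" y] pos[OF y(2)] P by (simp add: P_def)
    then show ?case using y(2) by simp
  qed
  have quot: "cf_quot x (Suc n) = b n" if P: "P b x" for b x n
  proof -
    obtain y where y: "cf_rem x n = 1 / (real (b n) + y)" "P (\<lambda>k. b (n + Suc k)) y"
      using unfold[OF cf[OF P, of n]] by auto
    then have "cf_quot (cf_rem x n) 1 = b n" unfolding y(1)
      using recip_cf(3)[of "b n" y] pos[OF y(2)] P by (simp add: P_def)
    then show ?thesis by (simp only: cf_quot_rem)
  qed
  have "(\<Inter>n. cf_cyl a n) \<noteq> {}"
  proof -
    have "{0..1} \<inter> (\<Inter>n\<in>UNIV. cf_cyl a n) \<noteq> {}"
    proof (rule compact_imp_fip_image)
      fix I :: "nat set" assume "finite I"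
      define N where "N = Max (insert 0 I)"
      have "cf_cyl a N \<subseteq> cf_cyl a n" if "n \<in> I" for n
        by (rule lift_Suc_antimono_le[of "cf_cyl a", OF cf_cyl_decseq[OF a]])
          (use that \<open>finite I\<close> in \<open>simp add: N_def\<close>)
      moreover have "cf_cyl a N \<subseteq> {0..1}" by (rule cf_cyl_subset[OF a])
      ultimately show "{0..1} \<inter> (\<Inter>n\<in>I. cf_cyl a n) \<noteq> {}"
        using cf_cyl_nonempty[of a N] by blast
    qed (auto intro: compact_imp_closed cf_cyl_compact a)
    then show ?thesis by blast
  qed
  then obtain x where x: "P a x" using a by (auto simp: P_def)
  have "x \<notin> \<rat>"
  proof
    assume "x \<in> \<rat>"
    then obtain n where "cf_rem x n = 0" using cf_rem_rat_terminates[of x] pos[OF x] by auto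
    then show False using pos[OF cf[OF x, of n]] by simp
  qed
  then show ?thesis using pos[OF x] quot[OF x] by blast
qed

section \<open>Blocks of quotients with small maximal drift\<close>

text \<open>
  The value of \<^const>\<open>phi1\<close> at the end of an initial word of partial quotients.
\<close>

definition drift :: "nat list \<Rightarrow> real" where
  "drift w = (\<Sum>a\<leftarrow>w. real a - kappa1)"

text \<open>
  A lower bound for \<open>S\<^sub>t - 2 log\<^sub>2 q\<^sub>t\<close> which, unlike that quantity, is additive over the word. Ones lower
  it by \<open>kappa1 - 1\<close>, large quotients raise it.
\<close>

definition surplus :: "nat list \<Rightarrow> real" where
  "surplus w = (\<Sum>a\<leftarrow>w. real a - kappa1 - 2 / ln 2 * ln (real a))"

text \<open>
  The surplus is required only from length \<open>n\<close> on, since a new block starts with a quotient that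
  raises it to the new level \<open>e\<close>; the ceiling \<open>m\<close> for the drift concerns all prefixes.
\<close>

definition controlled :: "nat \<Rightarrow> real \<Rightarrow> real \<Rightarrow> nat list \<Rightarrow> bool" where
  "controlled n e m w \<longleftrightarrow> (\<forall>a\<in>set w. 1 \<le> a) \<and>
     (\<forall>k. n \<le> k \<and> k \<le> length w \<longrightarrow> e \<le> surplus (take k w)) \<and>
     (\<forall>k\<le>length w. drift (take k w) \<le> m)"

lemma drift_append [simp]: "drift (u @ v) = drift u + drift v"
  and drift_Nil [simp]: "drift [] = 0"
  and drift_Cons [simp]: "drift (a # u) = real a - kappa1 + drift u"
  by (simp_all add: drift_def)

lemma surplus_append [simp]: "surplus (u @ v) = surplus u + surplus v"
  and surplus_Nil [simp]: "surplus [] = 0"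
  and surplus_Cons [simp]: "surplus (a # u) = real a - kappa1 - 2 / ln 2 * ln (real a) + surplus u"
  by (simp_all add: surplus_def)

lemma controlled_snoc:
  assumes "controlled n e m w" "1 \<le> a" "e \<le> surplus (w @ [a])" "drift (w @ [a]) \<le> m"
  shows "controlled n e m (w @ [a])"
  unfolding controlled_def
proof (intro conjI allI impI)
  fix k assume k: "k \<le> length (w @ [a])"
  then consider "k \<le> length w" | "k = length (w @ [a])" by fastforce
  then show "drift (take k (w @ [a])) \<le> m"
    by cases (use assms in \<open>auto simp: controlled_def\<close>)
next
  fix k assume k: "n \<le> k \<and> k \<le> length (w @ [a])"
  then consider "k \<le> length w" | "k = length (w @ [a])" by fastforce
  then show "e \<le> surplus (take k (w @ [a]))"
    by cases (use assms k in \<open>auto simp: controlled_def\<close>)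
qed (use assms in \<open>auto simp: controlled_def\<close>)

lemma controlled_ones:
  assumes w: "controlled n e m w" and e: "e + real r * (kappa1 - 1) \<le> surplus w"
  shows "controlled n e m (w @ replicate r 1) \<and>
    drift (w @ replicate r 1) = drift w - real r * (kappa1 - 1) \<and>
    surplus (w @ replicate r 1) = surplus w - real r * (kappa1 - 1)"
  using e
proof (induction r)
  case 0
  then show ?case using w by simp
next
  case (Suc r)
  have k: "0 < kappa1 - 1" using kappa1_gt_1 by simp
  have "e + real r * (kappa1 - 1) \<le> surplus w" using Suc.prems k by (simp add: algebra_simps)
  note IH = Suc.IH[OF this]
  have rep: "w @ replicate (Suc r) 1 = (w @ replicate r 1) @ [1]"
    by (simp add: replicate_append_same)
  have d: "drift (w @ replicate (Suc r) 1) = drift w - real (Suc r) * (kappa1 - 1)"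
    using IH unfolding rep drift_append[of "w @ replicate r 1"] by (simp add: algebra_simps)
  have s: "surplus (w @ replicate (Suc r) 1) = surplus w - real (Suc r) * (kappa1 - 1)"
    using IH unfolding rep surplus_append[of "w @ replicate r 1"] by (simp add: algebra_simps)
  have "drift (w @ replicate r 1) \<le> m" using IH by (auto simp: controlled_def)
  then have "drift (w @ replicate (Suc r) 1) \<le> m"
    using k unfolding rep drift_append[of "w @ replicate r 1"] by simp
  then have "controlled n e m (w @ replicate (Suc r) 1)"
    unfolding rep using IH s Suc.prems by (intro controlled_snoc) (auto simp: rep)
  then show ?case using d s by blast
qed

text \<open>
  A cycle is one large quotient \<open>A\<close>, which raises the surplus by at least \<open>A - kappa1 - l\<close>, followed by as
  many ones as this gain can feed. The drift jumps up by about \<open>A\<close>, then sinks by \<open>kappa1 - 1\<close> per step,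
  and ends at most \<open>l + (kappa1 - 1)\<close> above its start.
\<close>

lemma controlled_cycle:
  fixes A :: nat
  assumes w: "controlled n e m w" and n: "n \<le> length w"
    and A: "1 \<le> A" "drift w + real A \<le> m" "2 / ln 2 * ln (real A) \<le> l" "kappa1 + l \<le> real A"
  shows "\<exists>v. controlled n e m (w @ v) \<and> drift (w @ v) \<le> drift w + (l + (kappa1 - 1)) \<and>
    real A - kappa1 - l \<le> (kappa1 - 1) * real (length v)"
proof -
  define \<kappa> where "\<kappa> = kappa1 - 1"
  have k: "0 < \<kappa>" using kappa1_gt_1 by (simp add: \<kappa>_def)
  define r where "r = nat \<lfloor>(real A - kappa1 - l) / \<kappa>\<rfloor>"
  have "0 \<le> (real A - kappa1 - l) / \<kappa>" using A k by simp
  then have "real r \<le> (real A - kappa1 - l) / \<kappa>" "(real A - kappa1 - l) / \<kappa> \<le> real r + 1"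
    unfolding r_def by linarith+
  then have r: "real r * \<kappa> \<le> real A - kappa1 - l" "real A - kappa1 - l \<le> (real r + 1) * \<kappa>"
    using k by (simp_all add: pos_le_divide_eq pos_divide_le_eq)
  have ew: "e \<le> surplus w" using w n by (auto simp: controlled_def)
  have rk: "0 \<le> real r * \<kappa>" using k by simp
  have sA: "surplus (w @ [A]) = surplus w + (real A - kappa1 - 2 / ln 2 * ln (real A))" by simp
  have cA: "controlled n e m (w @ [A])"
  proof (rule controlled_snoc[OF w A(1)])
    show "e \<le> surplus (w @ [A])" unfolding sA using ew A(3) r rk by linarith
    show "drift (w @ [A]) \<le> m" using A(2) k by (simp add: \<kappa>_def)
  qed
  have "e + real r * (kappa1 - 1) \<le> surplus (w @ [A])"
    unfolding sA using ew A(3) r unfolding \<kappa>_def by linarith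
  note o = controlled_ones[OF cA this]
  have "drift ((w @ [A]) @ replicate r 1) \<le> drift w + (l + \<kappa>)"
    using o r by (simp add: \<kappa>_def algebra_simps)
  then show ?thesis using o r(2)
    by (intro exI[of _ "A # replicate r 1"]) (auto simp: \<kappa>_def mult.commute add.commute)
qed

text \<open>
  Repeat cycles, each time with essentially the largest quotient that keeps the drift below the
  ceiling \<open>m\<close>. The starting level rises by at most \<open>\<delta>\<close> per cycle, so the quotients may fall in
  arithmetic progression (up to rounding) and their sum, hence the total duration, is quadratic in the number of cycles.
\<close>

lemma controlled_cycles:
  assumes w: "controlled n e m w" and n: "n \<le> length w"
    and D: "drift w \<le> D" "0 \<le> D" and m: "1 \<le> m"
  defines "l \<equiv> 2 / ln 2 * ln m"
  defines "\<delta> \<equiv> l + (kappa1 - 1)" and "b \<equiv> m - D - 1 - kappa1 - l"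
  assumes j: "real j * \<delta> \<le> b"
  shows "\<exists>v. controlled n e m (w @ v) \<and> drift (w @ v) \<le> D + real j * \<delta> \<and>
    real j * b - \<delta> * (real j)\<^sup>2 / 2 \<le> (kappa1 - 1) * real (length v)"
  using j
proof (induction j)
  case 0
  then show ?case using w D by (intro exI[of _ "[]"]) simp
next
  case (Suc j)
  have l: "0 \<le> l" using m by (simp add: l_def)
  have \<delta>: "0 < \<delta>" using l kappa1_gt_1 by (simp add: \<delta>_def)
  have jb: "real j * \<delta> \<le> b - \<delta>" using Suc.prems by (simp add: algebra_simps)
  then have "real j * \<delta> \<le> b" using \<delta> by simp
  from Suc.IH[OF this] obtain v where v: "controlled n e m (w @ v)"
    "drift (w @ v) \<le> D + real j * \<delta>"
    "real j * b - \<delta> * (real j)\<^sup>2 / 2 \<le> (kappa1 - 1) * real (length v)" by blast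
  define A where "A = nat \<lfloor>m - D - real j * \<delta>\<rfloor>"
  have ge: "1 \<le> m - D - real j * \<delta>" using jb \<delta> l kappa1_gt_1 unfolding b_def by linarith
  have A: "real A \<le> m - D - real j * \<delta>" "m - D - real j * \<delta> - 1 \<le> real A" "1 \<le> A"
    using ge unfolding A_def by linarith+
  have "0 \<le> real j * \<delta>" using \<delta> by simp
  then have Am: "real A \<le> m" using A D by linarith
  have "\<exists>v'. controlled n e m ((w @ v) @ v') \<and> drift ((w @ v) @ v') \<le> drift (w @ v) + (l + (kappa1 - 1)) \<and>
    real A - kappa1 - l \<le> (kappa1 - 1) * real (length v')"
  proof (rule controlled_cycle[OF v(1)])
    show "2 / ln 2 * ln (real A) \<le> l"
      using Am A(3) unfolding l_def by (intro mult_left_mono) auto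
    show "drift (w @ v) + real A \<le> m" using v(2) A(1) by linarith
    show "kappa1 + l \<le> real A" using A(2) jb \<delta> unfolding b_def by linarith
  qed (use n A in auto)
  then obtain v' where v': "controlled n e m ((w @ v) @ v')"
    "drift ((w @ v) @ v') \<le> drift (w @ v) + \<delta>" "real A - kappa1 - l \<le> (kappa1 - 1) * real (length v')"
    unfolding \<delta>_def by blast
  have "b - real j * \<delta> \<le> (kappa1 - 1) * real (length v')" using v'(3) A(2) unfolding b_def by linarith
  then have "real j * b - \<delta> * (real j)\<^sup>2 / 2 + (b - real j * \<delta>) \<le> (kappa1 - 1) * real (length (v @ v'))"
    using v(3) by (simp add: distrib_left)
  moreover have "real (Suc j) * b - \<delta> * (real (Suc j))\<^sup>2 / 2
      = real j * b - \<delta> * (real j)\<^sup>2 / 2 + (b - real j * \<delta>) - \<delta> / 2"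
    by (simp add: power2_eq_square field_simps)
  ultimately have "real (Suc j) * b - \<delta> * (real (Suc j))\<^sup>2 / 2 \<le> (kappa1 - 1) * real (length (v @ v'))"
    using \<delta> by linarith
  moreover have "drift (w @ v @ v') \<le> D + real (Suc j) * \<delta>"
    using v(2) v'(2) by (simp add: algebra_simps)
  moreover have "controlled n e m (w @ v @ v')" using v'(1) by simp
  ultimately show ?case by blast
qed

text \<open>
  With \<open>m\<close> a constant for the initial level and \<open>N = c (t ln t)\<^sup>1\<^sup>/\<^sup>2\<close> as ceiling, about \<open>b / \<delta>\<close> cycles fit
  below it and last \<open>b\<^sup>2 / (2 \<delta>) \<sim> c\<^sup>2 t ln 2 / 2\<close> in units of \<open>1 / (kappa1 - 1)\<close> steps. For
  \<open>c\<^sup>2 > 2 kappa4\<^sup>2\<close> this outlasts \<open>t\<close>.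
\<close>

lemma block_length_asymptotics:
  fixes c m :: real
  assumes c: "0 < c" "2 * kappa4\<^sup>2 < c\<^sup>2"
  defines "\<delta> \<equiv> \<lambda>t::nat. 2 / ln 2 * ln (c * sqrt (real t * ln (real t))) + (kappa1 - 1)"
    and "b \<equiv> \<lambda>t::nat. c * sqrt (real t * ln (real t)) - m - 2 / ln 2 * ln (c * sqrt (real t * ln (real t)))"
  shows "\<forall>\<^sub>F t in sequentially. m < c * sqrt (real t * ln (real t)) \<and> 1 < c * sqrt (real t * ln (real t)) \<and> 0 < b t \<and>
     (kappa1 - 1) * real t \<le> ((b t)\<^sup>2 - (\<delta> t)\<^sup>2) / (2 * \<delta> t)"
proof -
  have k1: "kappa1 - 1 > 0" using kappa1_gt_1 by simp
  have lim: "(\<lambda>t. ((b t)\<^sup>2 - (\<delta> t)\<^sup>2) / (2 * \<delta> t) / real t) \<longlonglongrightarrow> c\<^sup>2 * ln 2 / 2"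
    unfolding b_def \<delta>_def using c(1) k1 by real_asymp
  have "2 * kappa4\<^sup>2 * ln 2 < c\<^sup>2 * ln 2" using c(2) by (intro mult_strict_right_mono) auto
  then have "kappa1 - 1 < c\<^sup>2 * ln 2 / 2" using kappa4_sq by linarith
  from order_tendstoD(1)[OF lim this] 
  have "\<forall>\<^sub>F t in sequentially. kappa1 - 1 < ((b t)\<^sup>2 - (\<delta> t)\<^sup>2) / (2 * \<delta> t) / real t" .
  moreover have "\<forall>\<^sub>F t in sequentially. m < c * sqrt (real t * ln (real t))" using c(1) by real_asymp
  moreover have "\<forall>\<^sub>F t in sequentially. 1 < c * sqrt (real t * ln (real t))" using c(1) by real_asymp
  moreover have "\<forall>\<^sub>F t in sequentially. 0 < b t" unfolding b_def using c(1) by real_asymp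
  moreover have "\<forall>\<^sub>F t in sequentially. 0 < t" by (rule eventually_gt_at_top)
  ultimately show ?thesis
  proof eventually_elim
    case (elim t)
    then have "(kappa1 - 1) * real t < ((b t)\<^sup>2 - (\<delta> t)\<^sup>2) / (2 * \<delta> t)"
      by (subst (asm) pos_less_divide_eq) auto
    then show ?case using elim by simp
  qed
qed

text \<open>
  Any word can be prolonged by a block that raises the surplus by 1 for good and at whose end the
  maximal drift is below the target. For this the time scale \<open>t\<close> is chosen so large that
  everything before is negligible against \<open>(t ln t)\<^sup>1\<^sup>/\<^sup>2\<close>; the block may run past \<open>t\<close>, which only
  increases the target.
\<close>

lemma controlled_extension:
  assumes u: "\<forall>a\<in>set u. 1 \<le> a" and c: "0 < c" "2 * kappa4\<^sup>2 < c\<^sup>2"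
  shows "\<exists>v. v \<noteq> [] \<and> controlled (Suc (length u)) (surplus u + 1)
    (c * sqrt (real (length (u @ v)) * ln (real (length (u @ v))))) (u @ v)"
proof -
  \<comment> \<open>The quotient \<open>16\<close> raises the surplus by \<open>16 - kappa1 - 8\<close>, since \<open>ln 16 / ln 2 = 4\<close>.\<close>
  define w where "w = u @ [16]"
  define M where "M = Max (insert 0 ((\<lambda>k. drift (take k w)) ` {..length w}))"
  have M: "0 \<le> M" "\<And>k. k \<le> length w \<Longrightarrow> drift (take k w) \<le> M"
    unfolding M_def by (intro Max_ge; simp)+
  have "\<forall>\<^sub>F t::nat in sequentially. 1 \<le> t" by (rule eventually_ge_at_top)
  from eventually_happens[OF eventually_conj[OF block_length_asymptotics[OF c, of "M + 1 + kappa1"] this]]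
  obtain t :: nat where t0:
    "M + 1 + kappa1 < c * sqrt (real t * ln (real t))" "1 < c * sqrt (real t * ln (real t))"
    "0 < c * sqrt (real t * ln (real t)) - (M + 1 + kappa1) - 2 / ln 2 * ln (c * sqrt (real t * ln (real t)))"
    "(kappa1 - 1) * real t
     \<le> ((c * sqrt (real t * ln (real t)) - (M + 1 + kappa1) - 2 / ln 2 * ln (c * sqrt (real t * ln (real t))))\<^sup>2 -
         (2 / ln 2 * ln (c * sqrt (real t * ln (real t))) + (kappa1 - 1))\<^sup>2) /
        (2 * (2 / ln 2 * ln (c * sqrt (real t * ln (real t))) + (kappa1 - 1)))" "1 \<le> t"
    by auto
  define N where "N = c * sqrt (real t * ln (real t))"
  define l where "l = 2 / ln 2 * ln N"
  define \<delta> where "\<delta> = l + (kappa1 - 1)"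
  define b where "b = N - M - 1 - kappa1 - l"
  have beq: "b = N - (M + 1 + kappa1) - 2 / ln 2 * ln N" by (simp add: b_def l_def)
  have t: "M + 1 + kappa1 < N" "1 < N" "0 < b" "(kappa1 - 1) * real t \<le> (b\<^sup>2 - \<delta>\<^sup>2) / (2 * \<delta>)" "1 \<le> t"
    using t0 unfolding beq \<delta>_def l_def N_def[symmetric] by blast+
  have l: "0 \<le> l" using t by (simp add: l_def)
  have \<delta>: "0 < \<delta>" using l kappa1_gt_1 by (simp add: \<delta>_def)
  have ln16: "ln (16::real) = 4 * ln 2"
    using ln_realpow[of 2 4] by simp
  have cw: "controlled (Suc (length u)) (surplus u + 1) N w"
    unfolding controlled_def
  proof (intro conjI allI impI)
    show "\<forall>a\<in>set w. 1 \<le> a" using u by (auto simp: w_def)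
    fix k assume "Suc (length u) \<le> k \<and> k \<le> length w"
    then have "k = length w" by (simp add: w_def)
    then have "take k w = w" by simp
    then show "surplus u + 1 \<le> surplus (take k w)" using ln16 kappa1_le_2 by (simp add: w_def)
  next
    fix k assume "k \<le> length w"
    then show "drift (take k w) \<le> N" using M(2)[of k] t(1) kappa1_gt_1 by simp
  qed
  define J where "J = nat \<lfloor>b / \<delta>\<rfloor>"
  have "0 \<le> b / \<delta>" using t \<delta> by simp
  then have J: "real J \<le> b / \<delta>" "b / \<delta> \<le> real J + 1" unfolding J_def by linarith+
  then have J: "real J * \<delta> \<le> b" "b \<le> (real J + 1) * \<delta>"
    using \<delta> by (simp_all add: pos_le_divide_eq pos_divide_le_eq)
  have "\<exists>v. controlled (Suc (length u)) (surplus u + 1) N (w @ v) \<and> drift (w @ v) \<le> M + real J * \<delta> \<and>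
    real J * b - \<delta> * (real J)\<^sup>2 / 2 \<le> (kappa1 - 1) * real (length v)"
    unfolding \<delta>_def b_def l_def
    by (rule controlled_cycles[OF cw])
      (use M(1) M(2)[of "length w"] t J(1) in \<open>auto simp: w_def \<delta>_def b_def l_def\<close>)
  then obtain v where v: "controlled (Suc (length u)) (surplus u + 1) N (w @ v)"
    "real J * b - \<delta> * (real J)\<^sup>2 / 2 \<le> (kappa1 - 1) * real (length v)" by blast
  \<comment> \<open>\<open>J\<close> is within \<open>1\<close> of the maximiser \<open>b / \<delta>\<close> of the quadratic length bound.\<close>
  have "(b - real J * \<delta>)\<^sup>2 \<le> \<delta>\<^sup>2" using J by (intro power_mono) (auto simp: algebra_simps)
  then have "(b\<^sup>2 - \<delta>\<^sup>2) / (2 * \<delta>) \<le> (b\<^sup>2 - (b - real J * \<delta>)\<^sup>2) / (2 * \<delta>)"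
    using \<delta> by (intro divide_right_mono) auto
  also have "\<dots> = real J * b - \<delta> * (real J)\<^sup>2 / 2" using \<delta> by (simp add: power2_eq_square field_simps)
  finally have "(kappa1 - 1) * real t \<le> (kappa1 - 1) * real (length v)" using t(4) v(2) by linarith
  then have "t \<le> length v" using kappa1_gt_1 by simp
  then have tl: "real t \<le> real (length (w @ v))" by simp
  have "N \<le> c * sqrt (real (length (w @ v)) * ln (real (length (w @ v))))"
    unfolding N_def using tl t(5) c(1) by (intro mult_left_mono real_sqrt_le_mono mult_mono) auto
  then have "controlled (Suc (length u)) (surplus u + 1)
    (c * sqrt (real (length (w @ v)) * ln (real (length (w @ v))))) (w @ v)"
    using v(1) unfolding controlled_def by (meson order_trans)
  then show ?thesis by (intro exI[of _ "16 # v"]) (simp add: w_def)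
qed

section \<open>The sequence attaining the bound\<close>

text \<open>
  Concatenate infinitely many such blocks: the surplus tends to infinity, and the end of every
  block is a time at which the drift has stayed below the target.
\<close>

lemma ex_sequence:
  fixes c :: real
  assumes c: "0 < c" "2 * kappa4\<^sup>2 < c\<^sup>2"
  shows "\<exists>a::nat \<Rightarrow> nat. (\<forall>k. 1 \<le> a k) \<and>
    filterlim (\<lambda>n. \<Sum>k<n. real (a k) - kappa1 - 2 / ln 2 * ln (real (a k))) at_top sequentially \<and>
    (\<exists>\<^sub>F t in sequentially. \<forall>u\<le>t. (\<Sum>k<u. real (a k) - kappa1) \<le> c * sqrt (real t * ln (real t)))"
proof -
  \<comment> \<open>\<open>W k\<close> is the word after \<open>k\<close> blocks; its length is the \<open>k\<close>-th of the favourable times.\<close>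
  define Q where "Q u v \<longleftrightarrow> v \<noteq> [] \<and> controlled (Suc (length u)) (surplus u + 1)
    (c * sqrt (real (length (u @ v)) * ln (real (length (u @ v))))) (u @ v)" for u v
  define W where "W = rec_nat [] (\<lambda>_ u. u @ (SOME v. Q u v))"
  have W0: "W 0 = []" and WS: "W (Suc k) = W k @ (SOME v. Q (W k) v)" for k
    by (simp_all add: W_def)
  have pos: "\<forall>a\<in>set (W k). 1 \<le> a" for k
  proof (induction k)
    case (Suc k)
    have "Q (W k) (SOME v. Q (W k) v)"
      using controlled_extension[OF Suc c] unfolding Q_def by (rule someI_ex)
    then show ?case unfolding WS Q_def controlled_def by blast
  qed (simp add: W0)
  have Q: "\<exists>v. W (Suc k) = W k @ v \<and> Q (W k) v" for k
  proof -
    have "Q (W k) (SOME v. Q (W k) v)"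
      using controlled_extension[OF pos c] unfolding Q_def by (rule someI_ex)
    then show ?thesis using WS by blast
  qed
  have con: "controlled (Suc (length (W k))) (surplus (W k) + 1)
    (c * sqrt (real (length (W (Suc k))) * ln (real (length (W (Suc k)))))) (W (Suc k))"
    and lenS: "length (W k) < length (W (Suc k))"
    and preS: "take (length (W k)) (W (Suc k)) = W k" for k
    using Q[of k] by (auto simp: Q_def)
  have len: "k \<le> length (W k)" for k
  proof (induction k)
    case (Suc k)
    then show ?case using lenS[of k] by linarith
  qed simp
  have pre: "take (length (W k)) (W (k + i)) = W k \<and> length (W k) \<le> length (W (k + i))" for k i
  proof (induction i)
    case (Suc i)
    have "take (length (W k)) (W (k + Suc i)) = take (length (W k)) (take (length (W (k + i))) (W (Suc (k + i))))"
      using Suc by (simp add: min_def)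
    then show ?case using Suc lenS[of "k + i"] by (simp add: preS)
  qed simp
  define a where "a i = W (Suc i) ! i" for i
  have nth: "W k ! i = a i" if "i < length (W k)" for k i
  proof (cases "k \<le> Suc i")
    case True
    then have "take (length (W k)) (W (Suc i)) = W k" using pre[of k "Suc i - k"] by simp
    then show ?thesis unfolding a_def using that by (metis nth_take)
  next
    case False
    then have "take (length (W (Suc i))) (W k) = W (Suc i)" using pre[of "Suc i" "k - Suc i"] by simp
    then show ?thesis unfolding a_def using len[of "Suc i"] by (metis Suc_le_lessD nth_take)
  qed
  have take: "take n (W k) = map a [0..<n]" if "n \<le> length (W k)" for n k
    by (rule nth_equalityI) (use that nth in auto)
  have dr: "(\<Sum>k<n. real (a k) - kappa1) = drift (take n (W k))" if "n \<le> length (W k)" for n k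
    unfolding take[OF that] by (simp add: drift_def interv_sum_list_conv_sum_set_nat o_def atLeast0LessThan)
  have su: "(\<Sum>k<n. real (a k) - kappa1 - 2 / ln 2 * ln (real (a k))) = surplus (take n (W k))"
    if "n \<le> length (W k)" for n k
    unfolding take[OF that] by (simp add: surplus_def interv_sum_list_conv_sum_set_nat o_def atLeast0LessThan)
  have sW: "real k \<le> surplus (W k)" for k
  proof (induction k)
    case (Suc k)
    have "surplus (W k) + 1 \<le> surplus (take (length (W (Suc k))) (W (Suc k)))"
      using con[of k] lenS[of k] unfolding controlled_def by (meson Suc_leI order_refl)
    then show ?case using Suc by simp
  qed (simp add: W0)
  have big: "real k \<le> surplus (take n (W (k + i)))" if "length (W k) < n" "n \<le> length (W (k + i))" for k i n
    using that
  proof (induction i)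
    case (Suc i)
    show ?case
    proof (cases "n \<le> length (W (k + i))")
      case True
      have "take n (W (k + Suc i)) = take n (take (length (W (k + i))) (W (Suc (k + i))))"
        using True by (simp add: min_def)
      then show ?thesis using Suc True by (simp add: preS)
    next
      case False
      then have "surplus (W (k + i)) + 1 \<le> surplus (take n (W (Suc (k + i))))"
        using con[of "k + i"] Suc.prems unfolding controlled_def by auto
      then show ?thesis using sW[of "k + i"] by simp
    qed
  qed simp
  have "a k \<ge> 1" for k
  proof -
    have "k < length (W (Suc k))" using len[of "Suc k"] by simp
    then show ?thesis unfolding a_def using pos[of "Suc k"] nth_mem by blast
  qed
  moreover have "filterlim (\<lambda>n. \<Sum>k<n. real (a k) - kappa1 - 2 / ln 2 * ln (real (a k))) at_top sequentially"
    unfolding filterlim_at_top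
  proof
    fix Z :: real
    obtain k :: nat where k: "Z \<le> real k" using real_arch_simple by blast
    show "\<forall>\<^sub>F n in sequentially. Z \<le> (\<Sum>k<n. real (a k) - kappa1 - 2 / ln 2 * ln (real (a k)))"
      unfolding eventually_sequentially
    proof (intro exI[of _ "Suc (length (W k))"] allI impI)
      fix n assume n: "Suc (length (W k)) \<le> n"
      have ln: "n \<le> length (W (k + n))" using len[of "k + n"] by simp
      then have "real k \<le> surplus (take n (W (k + n)))" using big[of k n n] n by simp
      then show "Z \<le> (\<Sum>k<n. real (a k) - kappa1 - 2 / ln 2 * ln (real (a k)))"
        using k unfolding su[OF ln] by linarith
    qed
  qed
  moreover have "\<exists>\<^sub>F t in sequentially. \<forall>u\<le>t. (\<Sum>k<u. real (a k) - kappa1) \<le> c * sqrt (real t * ln (real t))"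
    unfolding frequently_sequentially
  proof
    fix n
    have "\<forall>u\<le>length (W (Suc n)). (\<Sum>k<u. real (a k) - kappa1)
        \<le> c * sqrt (real (length (W (Suc n))) * ln (real (length (W (Suc n)))))"
      using con[of n] unfolding controlled_def by (simp add: dr[of _ "Suc n"])
    moreover have "n \<le> length (W (Suc n))" using len[of "Suc n"] by simp
    ultimately show "\<exists>t\<ge>n. \<forall>u\<le>t. (\<Sum>k<u. real (a k) - kappa1) \<le> c * sqrt (real t * ln (real t))"
      by blast
  qed
  ultimately show ?thesis by blast
qed

text \<open>
  The surplus is a lower bound for \<open>S\<^sub>t - 2 log\<^sub>2 q\<^sub>t\<close>, by the upper bound for the denominators.
\<close>

lemma surplus_den_tendsto:
  assumes a: "\<And>k. a k \<ge> 1"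
    and lim: "filterlim (\<lambda>n. \<Sum>k<n. real (a k) - kappa1 - 2 / ln 2 * ln (real (a k))) at_top sequentially"
  shows "(\<lambda>t. (cf_den a t)\<^sup>2 / 2 ^ (\<Sum>k<t. a k)) \<longlonglongrightarrow> 0"
proof -
  define E where "E n = (\<Sum>k<n. real (a k) - kappa1 - 2 / ln 2 * ln (real (a k)))" for n
  have bound: "(cf_den a t)\<^sup>2 / 2 ^ (\<Sum>k<t. a k) \<le> exp (- (ln 2 * E t))" for t
  proof -
    define P where "P = (\<Prod>k<t. real (a k))"
    define S where "S = (\<Sum>k<t. a k)"
    have P: "0 < P" unfolding P_def using a by (intro prod_pos) (auto simp: Suc_le_eq)
    have lnP: "ln P = (\<Sum>k<t. ln (real (a k)))"
      unfolding P_def using a by (intro ln_prod) (auto simp: Suc_le_eq)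
    have "E t = real S - kappa1 * real t - 2 / ln 2 * ln P"
      unfolding E_def lnP S_def by (simp add: sum_subtractf sum_distrib_left)
    then have "ln 2 * E t = ln 2 * (real S - kappa1 * real t - 2 / ln 2 * ln P)" by simp
    also have "\<dots> = real S * ln 2 - kappa1 * ln 2 * real t - 2 * ln P"
      by (simp add: right_diff_distrib)
    also have "\<dots> = real S * ln 2 - 2 * (real t * ln golden + ln P)"
      unfolding kappa1_ln by (simp add: algebra_simps)
    finally have e: "- (ln 2 * E t) = 2 * (real t * ln golden + ln P) - real S * ln 2" by simp
    have "(cf_den a t)\<^sup>2 \<le> (golden ^ t * P)\<^sup>2"
      using cf_den_upper[of a t, OF a] cf_den_ge_1[of a t, OF a] unfolding P_def by (intro power_mono) auto
    also have "\<dots> = exp (ln ((golden ^ t * P)\<^sup>2))" using P golden_gt_1 by simp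
    also have "ln ((golden ^ t * P)\<^sup>2) = 2 * (real t * ln golden + ln P)"
      using P golden_gt_1 by (simp add: ln_mult ln_realpow)
    finally have q: "(cf_den a t)\<^sup>2 / 2 ^ S \<le> exp (2 * (real t * ln golden + ln P)) / 2 ^ S"
      by (intro divide_right_mono) auto
    have "(2::real) ^ S = exp (real S * ln 2)"
      using exp_of_nat_mult[of S "ln (2::real)"] by simp
    then show ?thesis using q unfolding e exp_diff S_def[symmetric] by simp
  qed
  have "filterlim (\<lambda>t. ln 2 * E t) at_top sequentially"
    using lim unfolding E_def[symmetric] by (intro filterlim_tendsto_pos_mult_at_top[OF tendsto_const]) auto
  then have "filterlim (\<lambda>t. - (ln 2 * E t)) at_bot sequentially"
    by (simp add: filterlim_uminus_at_top)
  then have "(\<lambda>t. exp (- (ln 2 * E t))) \<longlonglongrightarrow> 0"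
    by (rule filterlim_compose[OF exp_at_bot])
  then show ?thesis
    by (rule tendsto_sandwich[OF _ _ tendsto_const, rotated 2]) (auto intro: always_eventually bound)
qed

lemma ex_max_phi1_upper:
  fixes \<epsilon> :: real
  assumes e: "\<epsilon> > 0"
  shows "\<exists>x::real. 0 < x \<and> x < 1 \<and> x \<notin> \<rat> \<and>
    (minkowski_qm has_real_derivative 0) (at x) \<and>
    (\<exists>\<^sub>F t in sequentially.
       Max (phi1 x ` {1..t}) \<le> (sqrt 2 + \<epsilon>) * kappa4 * sqrt (real t * ln (real t)))"
proof -
  define c where "c = (sqrt 2 + \<epsilon>) * kappa4"
  have "sqrt 2 * kappa4 < c" unfolding c_def using e kappa4_pos by (intro mult_strict_right_mono) auto
  moreover have p: "0 < sqrt 2 * kappa4" using kappa4_pos by simp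
  ultimately have "(sqrt 2 * kappa4)\<^sup>2 < c\<^sup>2" by (intro power_strict_mono) auto
  then have c: "2 * kappa4\<^sup>2 < c\<^sup>2" "0 < c"
    using p \<open>sqrt 2 * kappa4 < c\<close> by (auto simp: power_mult_distrib)
  obtain a :: "nat \<Rightarrow> nat" where a: "\<And>k. 1 \<le> a k"
    "filterlim (\<lambda>n. \<Sum>k<n. real (a k) - kappa1 - 2 / ln 2 * ln (real (a k))) at_top sequentially"
    "\<exists>\<^sub>F t in sequentially. \<forall>u\<le>t. (\<Sum>k<u. real (a k) - kappa1) \<le> c * sqrt (real t * ln (real t))"
    using ex_sequence[OF c(2,1)] by blast
  obtain x where x: "0 < x" "x < 1" "x \<notin> \<rat>" "\<And>k. cf_quot x (Suc k) = a k"
    using ex_irrational_cf[of a, OF a(1)] by auto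
  have "(minkowski_qm has_real_derivative 0) (at x)"
    by (rule den_bound_imp_deriv_0[OF x(1-3)])
      (use surplus_den_tendsto[of a, OF a(1,2)] in \<open>simp add: x(4) cf_sum_eq\<close>)
  moreover have "\<exists>\<^sub>F t in sequentially. Max (phi1 x ` {1..t}) \<le> c * sqrt (real t * ln (real t))"
  proof (rule frequently_rev_mp[OF a(3)])
    show "\<forall>\<^sub>F t in sequentially. (\<forall>u\<le>t. (\<Sum>k<u. real (a k) - kappa1) \<le> c * sqrt (real t * ln (real t)))
      \<longrightarrow> Max (phi1 x ` {1..t}) \<le> c * sqrt (real t * ln (real t))"
      using eventually_ge_at_top[of 1]
      by eventually_elim (auto simp: phi1_eq x(4))
  qed
  ultimately show ?thesis using x(1-3) unfolding c_def by blast
qed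

section \<open>Both bounds together\<close>

theorem theorem2:
  shows "(\<forall>x::real. 0 < x \<and> x < 1 \<and> x \<notin> \<rat> \<and>
            (minkowski_qm has_real_derivative 0) (at x) \<longrightarrow>
            (\<forall>\<epsilon>::real. \<epsilon> > 0 \<longrightarrow>
              (\<forall>\<^sub>F t in sequentially.
                 Max (phi1 x ` {1..t}) \<ge> (sqrt 2 - \<epsilon>) * kappa4 * sqrt (real t * ln (real t)))))
       \<and>
         (\<forall>\<epsilon>::real. \<epsilon> > 0 \<longrightarrow>
            (\<exists>x::real. 0 < x \<and> x < 1 \<and> x \<notin> \<rat> \<and>
              (minkowski_qm has_real_derivative 0) (at x) \<and>
              (\<exists>\<^sub>F t in sequentially.
                 Max (phi1 x ` {1..t}) \<le> (sqrt 2 + \<epsilon>) * kappa4 * sqrt (real t * ln (real t)))))"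
  using max_phi1_lower ex_max_phi1_upper by blast

end
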